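(* (1) For all $m,n\in\mathbb Z$ and $\lambda\in\mathbb T$, the unitary $u=\lambda U^mV^n$ is harmonic and is a strict local minimum of $E$ (strict modulo scalar multiples): there is a neighborhood $\mathcal N$ of $u$ in $U(A_\theta^\infty)$ such that $E(v)\ge E(u)$ for all $v\in\mathcal N$, with equality only if $v$ is a scalar multiple of $u$. (2) Any harmonic unitary $u\in A_\theta^\infty$ depending on $U$ alone is a scalar multiple of a power $U^m$ ($m\in\mathbb Z$) of $U$. Similarly, any harmonic unitary $u\in A_\theta^\infty$ depending on $V$ alone is a scalar multiple of a power $V^n$ ($n\in\mathbb Z$) of $V$.
   Context: Fix $\theta\in\mathbb R\smallsetminus\mathbb Q$. $A_\theta$ is the (universal) unital $C^*$-algebra generated by two unitaries $U,V$ with $UV=e^{2\pi i\theta}VU$; $\tau$ is its unique tracial state, given by $\tau(U^mV^n)=0$ for $(m,n)\neq(0,0)$ and $\tau(1)=1$. Its smooth subalgebra is $A_\theta^\infty=\{\sum_{m,n\in\mathbb Z}c_{m,n}U^mV^n: (c_{m,n})\text{ rapidly decreasing}\}$, with its usual Fréchet topology (seminorms $\sup_{m,n}(1+m^2+n^2)^k|c_{m,n}|$, $k\ge0$). The commuting derivations $\delta_1,\delta_2$ of $A_\theta^\infty$ are given by $\delta_1(U)=2\pi iU$, $\delta_1(V)=0$, $\delta_2(U)=0$, $\delta_2(V)=2\pi iV$, so $\delta_1(\sum c_{m,n}U^mV^n)=2\pi i\sum m\,c_{m,n}U^mV^n$ and $\delta_2(\sum c_{m,n}U^mV^n)=2\pi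 i\sum n\,c_{m,n}U^mV^n$. Write $U(A_\theta^\infty)$ for the group of unitaries in $A_\theta^\infty$, with the topology induced from $A_\theta^\infty$. The energy of $u\in U(A_\theta^\infty)$ is $E(u)=\tfrac12\tau\bigl((\delta_1(u))^*\delta_1(u)+(\delta_2(u))^*\delta_2(u)\bigr)$; it is invariant under multiplication of $u$ by scalars in $\mathbb T=\{z\in\mathbb C:|z|=1\}$, so it descends to the projective unitary group $PU(A_\theta^\infty)=U(A_\theta^\infty)/\mathbb T$. The unitary $u$ is called harmonic if it is a critical point of $E:U(A_\theta^\infty)\to[0,\infty)$, i.e. $\frac{d}{dt}\big|_{t=0}E(ue^{ith})=0$ for every $h=h^*\in A_\theta^\infty$. An element depends on $U$ alone if its Fourier coefficients $c_{m,n}$ vanish for $n\ne0$, and on $V$ alone if they vanish for $m\neq0$. *)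

theory Defs
  imports "HOL-Analysis.Analysis"
begin

section \<open>Unital C*-algebras\<close>

text \<open>
  The class \<^class>\<open>real_normed_algebra_1\<close> includes \<open>0 \<noteq> 1\<close>; the real scalar multiplication
  inherited from it (and hence the library's \<^const>\<open>exp\<close>) is tied to the complex one by
  \<open>scaleR_scaleC\<close>.
\<close>

class cstar_algebra = real_normed_algebra_1 + banach +
  fixes scaleC :: "complex \<Rightarrow> 'a \<Rightarrow> 'a"  (infixr \<open>*\<^sub>C\<close> 75)
    and star :: "'a \<Rightarrow> 'a"
  assumes scaleR_scaleC: "r *\<^sub>R x = complex_of_real r *\<^sub>C x"
    and scaleC_add_right: "c *\<^sub>C (x + y) = c *\<^sub>C x + c *\<^sub>C y"
    and scaleC_add_left: "(c + d) *\<^sub>C x = c *\<^sub>C x + d *\<^sub>C x"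
    and scaleC_scaleC: "c *\<^sub>C d *\<^sub>C x = (c * d) *\<^sub>C x"
    and mult_scaleC_left: "(c *\<^sub>C x) * y = c *\<^sub>C (x * y)"
    and mult_scaleC_right: "x * (c *\<^sub>C y) = c *\<^sub>C (x * y)"
    and norm_scaleC: "norm (c *\<^sub>C x) = cmod c * norm x"
    and star_star: "star (star x) = x"
    and star_add: "star (x + y) = star x + star y"
    and star_scaleC: "star (c *\<^sub>C x) = cnj c *\<^sub>C star x"
    and star_mult: "star (x * y) = star y * star x"
    and cstar_identity: "norm (star x * x) = (norm x)\<^sup>2"

definition unitary :: "'a::cstar_algebra \<Rightarrow> bool" where
  "unitary u \<longleftrightarrow> star u * u = 1 \<and> u * star u = 1"

text \<open>Integer powers, meant for unitary \<open>u\<close>, where \<open>star u\<close> is the inverse of \<open>u\<close>.\<close>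

definition upow :: "'a::cstar_algebra \<Rightarrow> int \<Rightarrow> 'a" where
  "upow u m = (if 0 \<le> m then u ^ nat m else star u ^ nat (- m))"

definition tracial_state :: "('a::cstar_algebra \<Rightarrow> complex) \<Rightarrow> bool" where
  "tracial_state \<tau> \<longleftrightarrow>
     bounded_linear \<tau> \<and>
     (\<forall>c x. \<tau> (c *\<^sub>C x) = c * \<tau> x) \<and>
     (\<forall>x. \<tau> (star x * x) \<in> \<real> \<and> 0 \<le> Re (\<tau> (star x * x))) \<and>
     \<tau> 1 = 1 \<and>
     (\<forall>x y. \<tau> (x * y) = \<tau> (y * x))"

section \<open>The irrational rotation algebra\<close>

inductive_set star_subalgebra :: "'a::cstar_algebra set \<Rightarrow> 'a set" for G where
  gen: "x \<in> G \<Longrightarrow> x \<in> star_subalgebra G"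
| one: "1 \<in> star_subalgebra G"
| add: "x \<in> star_subalgebra G \<Longrightarrow> y \<in> star_subalgebra G \<Longrightarrow> x + y \<in> star_subalgebra G"
| scale: "x \<in> star_subalgebra G \<Longrightarrow> c *\<^sub>C x \<in> star_subalgebra G"
| mult: "x \<in> star_subalgebra G \<Longrightarrow> y \<in> star_subalgebra G \<Longrightarrow> x * y \<in> star_subalgebra G"
| star: "x \<in> star_subalgebra G \<Longrightarrow> star x \<in> star_subalgebra G"

definition cstar_seminorm_on :: "'a::cstar_algebra set \<Rightarrow> ('a \<Rightarrow> real) \<Rightarrow> bool" where
  "cstar_seminorm_on S p \<longleftrightarrow>
     (\<forall>x\<in>S. 0 \<le> p x \<and> p (star x * x) = (p x)\<^sup>2 \<and> (\<forall>c. p (c *\<^sub>C x) = cmod c * p x)) \<and>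
     (\<forall>x\<in>S. \<forall>y\<in>S. p (x + y) \<le> p x + p y \<and> p (x * y) \<le> p x * p y)"

text \<open>
  The universal C*-algebra on two unitaries \<open>U\<close>, \<open>V\<close> with the commutation relation is the
  completion of the *-algebra they generate in the largest C*-seminorm; \<open>universal\<close> says that the
  norm of the ambient algebra is that largest one. (For irrational \<open>\<theta>\<close> the monomials
  \<open>U\<^sup>m V\<^sup>n\<close> are automatically linearly independent, so the *-subalgebra generated by \<open>U\<close> and
  \<open>V\<close> is the *-algebra presented by the relations.)
\<close>

locale irrational_rotation_algebra =
  fixes \<theta> :: real and U V :: "'a::cstar_algebra"
  assumes irrational: "\<theta> \<notin> \<rat>"
    and unitary_U: "unitary U"
    and unitary_V: "unitary V"
    and commutation: "U * V = exp (2 * pi * \<i> * \<theta>) *\<^sub>C (V * U)"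
    and generated: "closure (star_subalgebra {U, V}) = UNIV"
    and universal: "cstar_seminorm_on (star_subalgebra {U, V}) p \<Longrightarrow>
                      x \<in> star_subalgebra {U, V} \<Longrightarrow> p x \<le> norm x"

section \<open>The smooth subalgebra\<close>

definition weight :: "int \<Rightarrow> int \<Rightarrow> real" where
  "weight m n = 1 + (real_of_int m)\<^sup>2 + (real_of_int n)\<^sup>2"

definition rapidly_decreasing :: "(int \<Rightarrow> int \<Rightarrow> complex) \<Rightarrow> bool" where
  "rapidly_decreasing c \<longleftrightarrow>
     (\<forall>k::nat. bdd_above (range (\<lambda>(m, n). weight m n ^ k * cmod (c m n))))"

definition has_expansion ::
    "'a::cstar_algebra \<Rightarrow> 'a \<Rightarrow> (int \<Rightarrow> int \<Rightarrow> complex) \<Rightarrow> 'a \<Rightarrow> bool" where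
  "has_expansion U V c a \<longleftrightarrow>
     rapidly_decreasing c \<and> ((\<lambda>(m, n). c m n *\<^sub>C (upow U m * upow V n)) has_sum a) UNIV"

definition smooth :: "'a::cstar_algebra \<Rightarrow> 'a \<Rightarrow> 'a set" where
  "smooth U V = {a. \<exists>c. has_expansion U V c a}"

text \<open>
  The coefficients of a smooth element are unique in an irrational rotation algebra. On elements
  that are not smooth this and the notions built on it are unspecified.
\<close>

definition fourier_coeff :: "'a::cstar_algebra \<Rightarrow> 'a \<Rightarrow> 'a \<Rightarrow> int \<Rightarrow> int \<Rightarrow> complex" where
  "fourier_coeff U V a = (THE c. has_expansion U V c a)"

definition smooth_seminorm :: "'a::cstar_algebra \<Rightarrow> 'a \<Rightarrow> nat \<Rightarrow> 'a \<Rightarrow> real" where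
  "smooth_seminorm U V k a = (SUP (m, n)\<in>UNIV. weight m n ^ k * cmod (fourier_coeff U V a m n))"

definition smooth_topology :: "'a::cstar_algebra \<Rightarrow> 'a \<Rightarrow> 'a topology" where
  "smooth_topology U V = topology_generated_by
     {{b \<in> smooth U V. smooth_seminorm U V k (b - a) < \<epsilon>} | k a \<epsilon>. a \<in> smooth U V \<and> 0 < \<epsilon>}"

definition \<delta>\<^sub>1 :: "'a::cstar_algebra \<Rightarrow> 'a \<Rightarrow> 'a \<Rightarrow> 'a" where
  "\<delta>\<^sub>1 U V a = (\<Sum>\<^sub>\<infinity>(m, n)\<in>UNIV.
     (2 * pi * \<i> * of_int m * fourier_coeff U V a m n) *\<^sub>C (upow U m * upow V n))"

definition \<delta>\<^sub>2 :: "'a::cstar_algebra \<Rightarrow> 'a \<Rightarrow> 'a \<Rightarrow> 'a" where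
  "\<delta>\<^sub>2 U V a = (\<Sum>\<^sub>\<infinity>(m, n)\<in>UNIV.
     (2 * pi * \<i> * of_int n * fourier_coeff U V a m n) *\<^sub>C (upow U m * upow V n))"

definition depends_on_U_alone :: "'a::cstar_algebra \<Rightarrow> 'a \<Rightarrow> 'a \<Rightarrow> bool" where
  "depends_on_U_alone U V a \<longleftrightarrow> (\<forall>m n. n \<noteq> 0 \<longrightarrow> fourier_coeff U V a m n = 0)"

definition depends_on_V_alone :: "'a::cstar_algebra \<Rightarrow> 'a \<Rightarrow> 'a \<Rightarrow> bool" where
  "depends_on_V_alone U V a \<longleftrightarrow> (\<forall>m n. m \<noteq> 0 \<longrightarrow> fourier_coeff U V a m n = 0)"

section \<open>Energy and harmonic unitaries\<close>

definition smooth_unitaries :: "'a::cstar_algebra \<Rightarrow> 'a \<Rightarrow> 'a set" where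
  "smooth_unitaries U V = {u \<in> smooth U V. unitary u}"

definition unitary_topology :: "'a::cstar_algebra \<Rightarrow> 'a \<Rightarrow> 'a topology" where
  "unitary_topology U V = subtopology (smooth_topology U V) (smooth_unitaries U V)"

text \<open>The trace in the energy is a nonnegative real; \<^const>\<open>Re\<close> only adjusts the type.\<close>

definition energy :: "'a::cstar_algebra \<Rightarrow> 'a \<Rightarrow> ('a \<Rightarrow> complex) \<Rightarrow> 'a \<Rightarrow> real" where
  "energy U V \<tau> u =
     1 / 2 * Re (\<tau> (star (\<delta>\<^sub>1 U V u) * \<delta>\<^sub>1 U V u + star (\<delta>\<^sub>2 U V u) * \<delta>\<^sub>2 U V u))"

definition harmonic :: "'a::cstar_algebra \<Rightarrow> 'a \<Rightarrow> ('a \<Rightarrow> complex) \<Rightarrow> 'a \<Rightarrow> bool" where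
  "harmonic U V \<tau> u \<longleftrightarrow>
     u \<in> smooth_unitaries U V \<and>
     (\<forall>h \<in> smooth U V. star h = h \<longrightarrow>
        ((\<lambda>t::real. energy U V \<tau> (u * exp ((\<i> * t) *\<^sub>C h))) has_real_derivative 0) (at 0))"

definition unit_scalar_multiple :: "'a::cstar_algebra \<Rightarrow> 'a \<Rightarrow> bool" where
  "unit_scalar_multiple v u \<longleftrightarrow> (\<exists>\<mu>. cmod \<mu> = 1 \<and> v = \<mu> *\<^sub>C u)"

definition strict_local_min_mod_scalars ::
    "'a::cstar_algebra \<Rightarrow> 'a \<Rightarrow> ('a \<Rightarrow> complex) \<Rightarrow> 'a \<Rightarrow> bool" where
  "strict_local_min_mod_scalars U V \<tau> u \<longleftrightarrow>
     (\<exists>N. openin (unitary_topology U V) N \<and> u \<in> N \<and>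
        (\<forall>v\<in>N. energy U V \<tau> u \<le> energy U V \<tau> v \<and>
                (energy U V \<tau> v = energy U V \<tau> u \<longrightarrow> unit_scalar_multiple v u)))"

end

theory Submission imports Defs begin

text \<open>
  Write \<open>W p = U\<^sup>m V\<^sup>n\<close> for \<open>p = (m, n)\<close>, let \<open>D\<close> range over the two coordinate derivations
  \<open>W p \<mapsto> m W p\<close> and \<open>W p \<mapsto> n W p\<close>, and let \<open>\<parallel>x\<parallel>\<^sub>2\<close> be the trace norm \<open>\<tau>(x\<^sup>* x)\<^sup>1\<^sup>/\<^sup>2\<close>. Then
  the energy is \<open>2\<pi>\<^sup>2 \<Sum> \<parallel>D u\<parallel>\<^sub>2\<^sup>2\<close> (lemma \<open>energy_eq\<close>). Because \<open>\<theta>\<close> is irrational, \<open>\<tau>\<close> vanishes on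
  all \<open>W p\<close> with \<open>p \<noteq> 0\<close>, so \<open>\<tau>((W p)\<^sup>* a)\<close> is the Fourier coefficient of \<open>a\<close> at \<open>p\<close>, and all
  arguments about smooth elements can be made with these coefficients. The weighted \<open>\<ell>\<^sup>1\<close>-norms of
  the coefficients are submultiplicative and complete (\<open>smooth_series\<close>); this gives products and
  exponentials of smooth elements, together with the second-order Taylor bound on
  \<open>exp (ith)\<close> from which the derivative of the energy along \<open>u exp (ith)\<close> is read off:
  \<open>u\<close> is harmonic iff \<open>Re \<Sum> \<tau>((D u)\<^sup>* D (i u h)) = 0\<close> for all smooth self-adjoint \<open>h\<close>
  (\<open>harmonic_iff\<close>).

  For a multiple of \<open>W p\<close>, which is an eigenvector of each \<open>D\<close>, the sum is a real
  multiple of \<open>i \<tau>(h)\<close>, and \<open>\<tau>(h)\<close> is real. So monomials are harmonic.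

  Let \<open>u\<close> be harmonic and depend on one generator, so that only one derivation \<open>D\<close> matters. Put
  \<open>f = u\<^sup>* D u\<close>; differentiating \<open>u\<^sup>* u = 1\<close> shows that \<open>f\<close> is self-adjoint, and the Leibniz rule turns
  the condition into \<open>Re (i \<tau>(f D h)) = 0\<close>. The choice \<open>h = i D f\<close> gives \<open>\<parallel>D f\<parallel>\<^sub>2 = 0\<close>. Hence \<open>f\<close> is a
  scalar, \<open>u\<close> is an eigenvector of \<open>D\<close>, and \<open>u\<close> has a single nonzero coefficient.

  For the local minimum let \<open>u\<close> be a multiple of \<open>W s\<close>, let \<open>v\<close> be a smooth unitary near \<open>u\<close>, and
  \<open>a = u\<^sup>* v\<close>, with \<open>v\<close> rescaled so that \<open>\<tau>(a)\<close> is real. By the Leibniz rule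
  \<open>\<parallel>D (u a)\<parallel>\<^sub>2\<^sup>2 - \<parallel>D u\<parallel>\<^sub>2\<^sup>2 = \<parallel>D a\<parallel>\<^sub>2\<^sup>2 + 2 k Re \<tau>(a\<^sup>* D a)\<close>, where \<open>k\<close> is the coordinate of \<open>s\<close>. Put
  \<open>d = a - a\<^sup>*\<close> and \<open>b = a + a\<^sup>* - 2\<close>. The term of indefinite sign equals \<open>k \<tau>(b D d)\<close> up to
  an imaginary part, and since \<open>a\<close> is unitary, \<open>4b = d\<^sup>2 - b\<^sup>2\<close>: thus \<open>b\<close> is of second order
  in \<open>d\<close>, and that term is of third order, whereas \<open>\<parallel>D a\<parallel>\<^sub>2\<close> is at least
  \<open>\<parallel>D d\<parallel>\<^sub>2 / 2\<close>. As \<open>\<tau>(d) = 0\<close>, the norm of \<open>d\<close> is controlled by those of its derivatives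
  (\<open>Poincare\<close>), so for \<open>v\<close> close to \<open>u\<close> the quadratic term wins; equality forces \<open>d = b = 0\<close>,
  that is \<open>a = 1\<close>.
\<close>

section \<open>Calculus in a C*-algebra\<close>

context
  fixes x y :: "'a::cstar_algebra"
begin

lemma scaleC_zero_right [simp]: "c *\<^sub>C (0::'a) = 0"
  using scaleC_add_right[of c "0::'a" 0] by simp

lemma scaleC_zero_left [simp]: "0 *\<^sub>C x = 0"
  using scaleC_add_left[of 0 0 x] by simp

lemma scaleC_one [simp]: "1 *\<^sub>C x = x"
  using scaleR_scaleC[of 1 x] by simp

lemma scaleC_minus_right: "c *\<^sub>C (- x) = - (c *\<^sub>C x)"
  using scaleC_add_right[of c x "- x"] by (simp add: eq_neg_iff_add_eq_0 add.commute)

lemma scaleC_minus_left: "(- c) *\<^sub>C x = - (c *\<^sub>C x)"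
  using scaleC_add_left[of c "- c" x] by (simp add: eq_neg_iff_add_eq_0 add.commute)

lemma scaleC_diff_right: "c *\<^sub>C (x - y) = c *\<^sub>C x - c *\<^sub>C y"
  using scaleC_add_right[of c x "- y"] scaleC_minus_right
  by (metis add_uminus_conv_diff scaleC_add_right add_diff_cancel diff_add_cancel)

lemma scaleC_diff_left: "(c - d) *\<^sub>C x = c *\<^sub>C x - d *\<^sub>C x"
  by (metis add_diff_cancel diff_add_cancel scaleC_add_left)

lemma star_zero [simp]: "star (0::'a) = 0"
  using star_add[of "0::'a" 0] by simp

lemma star_minus: "star (- x) = - star x"
  using star_add[of x "- x"] by (simp add: eq_neg_iff_add_eq_0 add.commute)

lemma star_diff: "star (x - y) = star x - star y"
  by (metis add_diff_cancel diff_add_cancel star_add)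

lemma star_one [simp]: "star (1::'a) = 1"
  by (metis mult_1_left mult_1_right star_mult star_star)

lemma norm_star [simp]: "norm (star x) = norm x"
proof -
  have le: "norm (z::'a) \<le> norm (star z)" for z
  proof (cases "norm z = 0")
    case False
    have "norm z * norm z \<le> norm (star z) * norm z"
      by (metis cstar_identity norm_mult_ineq power2_eq_square)
    with False show ?thesis by simp
  qed simp
  show ?thesis using le[of x] le[of "star x"] by (simp add: star_star)
qed

end

lemma bounded_linear_scaleC_right: "bounded_linear (\<lambda>x::'a::cstar_algebra. c *\<^sub>C x)"
  by (rule bounded_linear_intro[of _ "cmod c"])
     (auto simp: scaleC_add_right scaleR_scaleC scaleC_scaleC norm_scaleC mult.commute)

lemma bounded_linear_scaleC_left: "bounded_linear (\<lambda>c. c *\<^sub>C (x::'a::cstar_algebra))"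
  by (rule bounded_linear_intro[of _ "norm x"])
     (auto simp: scaleC_add_left scaleR_scaleC scaleC_scaleC norm_scaleC scaleR_conv_of_real)

lemma bounded_linear_star: "bounded_linear (star :: 'a::cstar_algebra \<Rightarrow> 'a)"
  by (rule bounded_linear_intro[of _ 1]) (auto simp: star_add scaleR_scaleC star_scaleC)

lemma unitary_star: "unitary u \<Longrightarrow> unitary (star u)"
  by (simp add: unitary_def star_star)

lemma unitary_mult: "unitary u \<Longrightarrow> unitary v \<Longrightarrow> unitary (u * v)"
  unfolding unitary_def star_mult by (metis mult.assoc mult_1_left)

lemma unitary_scaleC: "unitary u \<Longrightarrow> cmod c = 1 \<Longrightarrow> unitary (c *\<^sub>C u)"
  by (simp add: unitary_def star_scaleC mult_scaleC_left mult_scaleC_right scaleC_scaleC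
      complex_norm_square[symmetric] mult.commute[of "cnj c"])

lemma unitary_cancel: "unitary u \<Longrightarrow> star u * (u * x) = x" "unitary u \<Longrightarrow> u * (star u * x) = x"
  by (simp_all add: unitary_def mult.assoc[symmetric])

section \<open>Integer powers of unitaries\<close>

lemma upow_0 [simp]: "upow u 0 = 1"
  by (simp add: upow_def)

lemma upow_Suc: assumes "unitary u" shows "upow u (m + 1) = u * upow u m"
proof (cases "0 \<le> m")
  case True then show ?thesis by (simp add: upow_def nat_add_distrib)
next
  case False
  then obtain k where k: "m = - int (Suc k)" by (metis int_cases linorder_not_le of_nat_0_le_iff)
  show ?thesis using assms unfolding k
    by (cases k) (auto simp: upow_def nat_add_distrib unitary_cancel unitary_def)
qed

lemma upow_pred: assumes "unitary u" shows "upow u (m - 1) = star u * upow u m"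
  using upow_Suc[OF assms, of "m - 1"] unitary_cancel(1)[OF assms] by simp

lemma upow_add: assumes "unitary u" shows "upow u (m + n) = upow u m * upow u n"
proof (induct m rule: int_induct[where k = 0])
  case (step1 i)
  then show ?case using upow_Suc[OF assms, of "i + n"] upow_Suc[OF assms, of i]
    by (simp add: algebra_simps)
next
  case (step2 i)
  then show ?case using upow_pred[OF assms, of "i + n"] upow_pred[OF assms, of i]
    by (simp add: algebra_simps)
qed simp

lemma unitary_power: "unitary u \<Longrightarrow> unitary (u ^ n)"
  by (induct n) (simp add: unitary_def, simp add: unitary_mult)

lemma unitary_upow: "unitary u \<Longrightarrow> unitary (upow u m)"
  by (auto simp: upow_def intro: unitary_power unitary_star)

text \<open>
  The inverse of \<open>x\<close> commutes with \<open>y\<close> up to \<open>l\<^sup>-\<^sup>1\<close>, which makes the induction run in both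
  directions over the integers.
\<close>

lemma mult_upow_commute:
  assumes x: "unitary x" and l: "l \<noteq> 0" and c: "y * x = l *\<^sub>C (x * y)"
  shows "y * upow x m = (l powi m) *\<^sub>C (upow x m * y)"
proof (induct m rule: int_induct[where k = 0])
  case (step1 i)
  have "y * upow x (i + 1) = (y * x) * upow x i" by (simp add: upow_Suc[OF x] mult.assoc)
  also have "\<dots> = (l * l powi i) *\<^sub>C (x * upow x i * y)"
    by (simp add: c mult_scaleC_left mult_scaleC_right mult.assoc step1 scaleC_scaleC)
  finally show ?case by (simp add: upow_Suc[OF x] power_int_add_1' l)
next
  case (step2 i)
  have "star x * (y * x) * star x = l *\<^sub>C (star x * x * y * star x)"
    by (simp add: c mult_scaleC_left mult_scaleC_right mult.assoc)
  then have "star x * y = l *\<^sub>C (y * star x)"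
    by (simp only: mult.assoc unitary_cancel(1)[OF x]) (use x in \<open>simp add: unitary_def\<close>)
  then have c': "y * star x = inverse l *\<^sub>C (star x * y)"
    using l by (simp add: scaleC_scaleC)
  have "y * upow x (i - 1) = (y * star x) * upow x i" by (simp add: upow_pred[OF x] mult.assoc)
  also have "\<dots> = (inverse l * l powi i) *\<^sub>C (star x * upow x i * y)"
    by (simp add: c' mult_scaleC_left mult_scaleC_right mult.assoc step2 scaleC_scaleC)
  finally show ?case using l by (simp add: upow_pred[OF x] power_int_diff field_simps)
qed simp

text \<open>
  Moving \<open>y\<close> past \<open>upow x m\<close> is again a relation of the same shape, with \<open>l\<^sup>m\<close> in the place of \<open>l\<close>
  and the two roles exchanged.
\<close>

lemma upow_mult_upow_commute:
  assumes x: "unitary x" and y: "unitary y" and l: "l \<noteq> 0" and c: "y * x = l *\<^sub>C (x * y)"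
  shows "upow y n * upow x m = (l powi (m * n)) *\<^sub>C (upow x m * upow y n)"
proof -
  have "upow x m * y = inverse (l powi m) *\<^sub>C (y * upow x m)"
    using mult_upow_commute[OF x l c, of m] l by (simp add: scaleC_scaleC)
  then have "upow x m * upow y n = (inverse (l powi m) powi n) *\<^sub>C (upow y n * upow x m)"
    by (rule mult_upow_commute[OF y, rotated]) (simp add: l)
  then show ?thesis using l
    by (simp add: scaleC_scaleC power_int_mult power_int_inverse)
qed

section \<open>Tracial states\<close>

lemma cnj_sgn_mult: "cnj (sgn z) * z = complex_of_real (cmod z)"
proof (cases "z = 0")
  case False
  have "cnj (sgn z) * z = (z * cnj z) / complex_of_real (cmod z)" by (simp add: sgn_eq)
  also have "\<dots> = complex_of_real ((cmod z)\<^sup>2) / complex_of_real (cmod z)"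
    by (simp only: complex_norm_square)
  finally show ?thesis using False by (simp add: power2_eq_square)
qed simp

locale tracial =
  fixes \<tau> :: "'a::cstar_algebra \<Rightarrow> complex"
  assumes tracial: "tracial_state \<tau>"
begin

lemma bounded_linear_trace: "bounded_linear \<tau>"
  and trace_scaleC: "\<tau> (c *\<^sub>C x) = c * \<tau> x"
  and trace_positive: "Im (\<tau> (star x * x)) = 0" "0 \<le> Re (\<tau> (star x * x))"
  and trace_one: "\<tau> 1 = 1"
  and trace_commute: "\<tau> (x * y) = \<tau> (y * x)"
  using tracial by (auto simp: tracial_state_def complex_is_Real_iff)

lemma trace_add: "\<tau> (x + y) = \<tau> x + \<tau> y"
  and trace_diff: "\<tau> (x - y) = \<tau> x - \<tau> y"
  and trace_minus: "\<tau> (- x) = - \<tau> x"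
  and trace_zero: "\<tau> 0 = 0"
  using bounded_linear_trace
  by (auto simp: linear_simps)

text \<open>Polarization: \<open>\<tau>\<close> is real at \<open>(1 + x)\<^sup>* (1 + x)\<close> and at \<open>(1 + ix)\<^sup>* (1 + ix)\<close>.\<close>

lemma trace_star: "\<tau> (star x) = cnj (\<tau> x)"
proof -
  have "Im (\<tau> (star x) + \<tau> x) = 0"
    using trace_positive(1)[of "1 + x"] trace_positive(1)[of x]
    by (simp add: star_add algebra_simps trace_add trace_one)
  moreover have "Im (\<i> * \<tau> x - \<i> * \<tau> (star x)) = 0"
    using trace_positive(1)[of "1 + \<i> *\<^sub>C x"] trace_positive(1)[of x]
    by (simp add: star_add algebra_simps trace_add trace_one mult_scaleC_left mult_scaleC_right
        star_scaleC trace_scaleC scaleC_scaleC)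
  ultimately show ?thesis by (simp add: complex_eq_iff)
qed

definition norm2 :: "'a \<Rightarrow> real" where
  "norm2 x = sqrt (Re (\<tau> (star x * x)))"

lemma norm2_nonneg [simp]: "0 \<le> norm2 x"
  by (simp add: norm2_def trace_positive)

lemma norm2_square: "(norm2 x)\<^sup>2 = Re (\<tau> (star x * x))"
  by (simp add: norm2_def trace_positive)

lemma norm2_square_complex: "complex_of_real ((norm2 x)\<^sup>2) = \<tau> (star x * x)"
  by (simp add: complex_eq_iff norm2_square trace_positive)

lemma norm2_add_square:
  "(norm2 (x + y))\<^sup>2 = (norm2 x)\<^sup>2 + 2 * Re (\<tau> (star x * y)) + (norm2 y)\<^sup>2"
  using trace_star[of "star x * y"]
  by (simp add: norm2_square star_add star_mult star_star algebra_simps trace_add)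

lemma norm2_scaleC: "norm2 (c *\<^sub>C x) = cmod c * norm2 x"
proof -
  have "(norm2 (c *\<^sub>C x))\<^sup>2 = (cmod c * norm2 x)\<^sup>2"
    using complex_norm_square[of c, symmetric]
    by (simp add: norm2_square star_scaleC mult_scaleC_left mult_scaleC_right scaleC_scaleC
        trace_scaleC power_mult_distrib mult.commute[of "cnj c"])
  then show ?thesis by (simp add: power2_eq_iff_nonneg)
qed

lemma norm2_minus [simp]: "norm2 (- x) = norm2 x"
  by (simp add: norm2_def star_minus)

lemma norm2_star [simp]: "norm2 (star x) = norm2 x"
  by (simp add: norm2_def star_star trace_commute)

lemma norm2_unitary_mult: "unitary u \<Longrightarrow> norm2 (u * x) = norm2 x"
  by (simp add: norm2_def star_mult unitary_cancel mult.assoc)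

text \<open>
  The quadratic polynomial \<open>t \<mapsto> norm2 (x + t y)\<^sup>2\<close> is nonnegative, hence its discriminant is not
  positive; turning \<open>y\<close> by a phase replaces the real part by the modulus.
\<close>

lemma trace_Cauchy_Schwarz: "cmod (\<tau> (star x * y)) \<le> norm2 x * norm2 y"
proof -
  have re: "(Re (\<tau> (star x * z)))\<^sup>2 \<le> (norm2 x)\<^sup>2 * (norm2 z)\<^sup>2" for z
  proof -
    define A where "A = (norm2 x)\<^sup>2"
    define B where "B = Re (\<tau> (star x * z))"
    define C where "C = (norm2 z)\<^sup>2"
    have nn: "0 \<le> A + 2 * t * B + t\<^sup>2 * C" for t :: real
    proof -
      have "A + 2 * t * B + t\<^sup>2 * C = (norm2 (x + complex_of_real t *\<^sub>C z))\<^sup>2"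
        by (simp add: norm2_add_square mult_scaleC_right trace_scaleC norm2_scaleC
            power_mult_distrib A_def B_def C_def)
      then show ?thesis by simp
    qed
    have "B\<^sup>2 \<le> A * C"
    proof (cases "C = 0")
      case True
      have "B = 0"
      proof (rule ccontr)
        assume "B \<noteq> 0"
        \<comment> \<open>Without a quadratic term the polynomial takes the value \<open>-1\<close> here.\<close>
        then have "2 * (- (A + 1) / (2 * B)) * B = - (A + 1)" by simp
        then show False using nn[of "- (A + 1) / (2 * B)"] True by simp
      qed
      then show ?thesis using True by simp
    next
      case False
      then have C: "C > 0" by (simp add: C_def)
      have "0 \<le> C * (A + 2 * (- B / C) * B + (- B / C)\<^sup>2 * C)"
        using nn[of "- B / C"] C by (intro mult_nonneg_nonneg) auto
      then show ?thesis using C by (simp add: field_simps power2_eq_square)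
    qed
    then show ?thesis by (simp add: A_def B_def C_def)
  qed
  define c where "c = cnj (sgn (\<tau> (star x * y)))"
  have c1: "cmod c \<le> 1" by (simp add: c_def norm_sgn)
  have "\<tau> (star x * (c *\<^sub>C y)) = complex_of_real (cmod (\<tau> (star x * y)))"
    by (simp only: mult_scaleC_right trace_scaleC c_def cnj_sgn_mult)
  then have "(cmod (\<tau> (star x * y)))\<^sup>2 \<le> (norm2 x)\<^sup>2 * (norm2 (c *\<^sub>C y))\<^sup>2"
    using re[of "c *\<^sub>C y"] by (simp only: Re_complex_of_real)
  also have "\<dots> \<le> (norm2 x)\<^sup>2 * (norm2 y)\<^sup>2"
    using c1 by (intro mult_left_mono power_mono) (auto simp: norm2_scaleC mult_left_le_one_le)
  finally show ?thesis
    unfolding power_mult_distrib[symmetric] by (rule power2_le_imp_le) simp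
qed

lemma norm2_triangle: "norm2 (x + y) \<le> norm2 x + norm2 y"
proof -
  have "Re (\<tau> (star x * y)) \<le> norm2 x * norm2 y"
    using trace_Cauchy_Schwarz complex_Re_le_cmod order_trans by blast
  then have "(norm2 (x + y))\<^sup>2 \<le> (norm2 x + norm2 y)\<^sup>2"
    by (simp add: norm2_add_square power2_sum)
  then show ?thesis by (rule power2_le_imp_le) simp
qed

lemma norm2_triangle_diff: "norm2 (x - y) \<le> norm2 x + norm2 y"
  using norm2_triangle[of x "- y"] by simp

end

section \<open>Summability over the lattice\<close>

text \<open>
  Unlike \<^const>\<open>weight\<close> this weight is submultiplicative. Each is bounded by a power of the other,
  so that both describe rapid decrease.
\<close>

definition wt :: "int \<times> int \<Rightarrow> real" where
  "wt p = 1 + \<bar>real_of_int (fst p)\<bar> + \<bar>real_of_int (snd p)\<bar>"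

lemma wt_ge_1: "1 \<le> wt p"
  by (simp add: wt_def)

lemma wt_pos [simp]: "0 < wt p" "0 \<le> wt p"
  using wt_ge_1[of p] by auto

lemma wt_add_le: "wt (p + q) \<le> wt p * wt q"
proof -
  have "wt (p + q) \<le> 1 + (\<bar>real_of_int (fst p)\<bar> + \<bar>real_of_int (snd p)\<bar>)
      + (\<bar>real_of_int (fst q)\<bar> + \<bar>real_of_int (snd q)\<bar>)"
    by (simp add: wt_def)
  also have "\<dots> \<le> wt p * wt q"
    by (simp add: wt_def algebra_simps)
  finally show ?thesis .
qed

lemma abs_int_le_square: "\<bar>real_of_int m\<bar> \<le> (real_of_int m)\<^sup>2"
proof -
  have "\<bar>m\<bar> * 1 \<le> \<bar>m\<bar> * \<bar>m\<bar>"
    by (cases "m = 0") (auto intro!: mult_left_mono simp del: abs_mult_self_eq)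
  then have "\<bar>m\<bar> \<le> m\<^sup>2" by (simp add: power2_eq_square)
  then have "real_of_int \<bar>m\<bar> \<le> real_of_int (m\<^sup>2)" by (simp only: of_int_le_iff)
  then show ?thesis by simp
qed

lemma wt_le_weight: "wt (m, n) \<le> weight m n"
  using abs_int_le_square[of m] abs_int_le_square[of n] by (simp add: wt_def weight_def)

lemma weight_le_wt: "weight m n \<le> wt (m, n) ^ 2"
proof -
  have "0 \<le> (\<bar>real_of_int m\<bar> + \<bar>real_of_int n\<bar>) + \<bar>real_of_int m\<bar> * \<bar>real_of_int n\<bar>" by simp
  then show ?thesis unfolding wt_def weight_def power2_eq_square
    by (simp add: algebra_simps)
qed

lemma weight_ge_1: "1 \<le> weight m n"
  by (simp add: weight_def)

lemma summable_on_inverse_square: "(\<lambda>m::int. 1 / (1 + (real_of_int m)\<^sup>2)) summable_on UNIV"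
proof -
  have "summable (\<lambda>n. inverse (real n ^ 2))"
    by (rule inverse_power_summable) simp
  then have "summable (\<lambda>n. inverse (1 + (real n)\<^sup>2))"
    by (rule summable_comparison_test_ev[rotated])
       (auto intro!: always_eventually eventually_sequentiallyI[of 1] le_imp_inverse_le)
  then have "(\<lambda>n. inverse (1 + (real n)\<^sup>2)) summable_on UNIV"
    by (rule summable_nonneg_imp_summable_on) auto
  then have N: "(\<lambda>n. 1 / (1 + (real n)\<^sup>2)) summable_on UNIV"
    by (simp add: inverse_eq_divide)
  have "(\<lambda>m. 1 / (1 + (real_of_int m)\<^sup>2)) summable_on range int"
    "(\<lambda>m. 1 / (1 + (real_of_int m)\<^sup>2)) summable_on range (\<lambda>n. - int n)"
    using N by (auto simp: summable_on_reindex inj_on_def o_def)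
  then have "(\<lambda>m. 1 / (1 + (real_of_int m)\<^sup>2)) summable_on range int \<union> range (\<lambda>n. - int n)"
    by (rule summable_on_union)
  moreover have "range int \<union> range (\<lambda>n. - int n) = UNIV"
    by (auto intro: int_cases2)
  ultimately show ?thesis by simp
qed

lemma summable_on_inverse_weight: "(\<lambda>(m, n). 1 / weight m n ^ 2) summable_on UNIV"
proof -
  let ?g = "\<lambda>m::int. 1 / (1 + (real_of_int m)\<^sup>2)"
  have "(\<lambda>(m, n). ?g m * ?g n) summable_on UNIV \<times> UNIV"
  proof (rule summable_on_SigmaI)
    show "((\<lambda>n. case (m, n) of (m, n) \<Rightarrow> ?g m * ?g n) has_sum ?g m * infsum ?g UNIV) UNIV" for m
      using has_sum_cmult_right[OF has_sum_infsum[OF summable_on_inverse_square], of "?g m"]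
      by (simp only: prod.case)
    show "(\<lambda>m. ?g m * infsum ?g UNIV) summable_on UNIV"
      by (rule summable_on_cmult_left[OF summable_on_inverse_square])
  qed auto
  then have "(\<lambda>(m, n). ?g m * ?g n) summable_on UNIV" by simp
  then show ?thesis
  proof (rule summable_on_comparison_test)
    fix p :: "int \<times> int"
    obtain m n where p: "p = (m, n)" by force
    have "(1 + (real_of_int m)\<^sup>2) * (1 + (real_of_int n)\<^sup>2) \<le> weight m n * weight m n"
      unfolding weight_def by (intro mult_mono) auto
    then have "1 / (weight m n * weight m n) \<le> 1 / ((1 + (real_of_int m)\<^sup>2) * (1 + (real_of_int n)\<^sup>2))"
      by (intro divide_left_mono) (auto intro!: mult_pos_pos add_pos_nonneg simp: weight_def)
    then show "(case p of (m, n) \<Rightarrow> 1 / weight m n ^ 2) \<le> (case p of (m, n) \<Rightarrow> ?g m * ?g n)"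
      by (simp add: p power2_eq_square)
    show "0 \<le> (case p of (m, n) \<Rightarrow> 1 / weight m n ^ 2)" by (simp add: p)
  qed
qed

text \<open>
  The two extra powers of the weight pay for passing from a supremum to a sum.
\<close>

lemma rapidly_decreasing_iff_summable:
  "rapidly_decreasing c \<longleftrightarrow> (\<forall>k. (\<lambda>p. wt p ^ k * cmod (case_prod c p)) summable_on UNIV)"
proof
  assume c: "rapidly_decreasing c"
  show "\<forall>k. (\<lambda>p. wt p ^ k * cmod (case_prod c p)) summable_on UNIV"
  proof
    fix k
    obtain C where C: "\<And>m n. weight m n ^ (k + 2) * cmod (c m n) \<le> C"
      using c unfolding rapidly_decreasing_def bdd_above_def by fastforce
    have "(\<lambda>p. C * (case p of (m, n) \<Rightarrow> 1 / weight m n ^ 2)) summable_on UNIV"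
      by (rule summable_on_cmult_right[OF summable_on_inverse_weight])
    then show "(\<lambda>p. wt p ^ k * cmod (case_prod c p)) summable_on UNIV"
    proof (rule summable_on_comparison_test)
      fix p :: "int \<times> int"
      obtain m n where p: "p = (m, n)" by force
      have "wt p ^ k * cmod (c m n) \<le> weight m n ^ k * cmod (c m n)"
        unfolding p by (intro mult_right_mono power_mono wt_le_weight) auto
      also have "\<dots> = (weight m n ^ (k + 2) * cmod (c m n)) * (1 / weight m n ^ 2)"
        using weight_ge_1[of m n] by (simp add: power_add power2_eq_square)
      also have "\<dots> \<le> C * (1 / weight m n ^ 2)"
        by (intro mult_right_mono C) simp
      finally show "wt p ^ k * cmod (case_prod c p) \<le> C * (case p of (m, n) \<Rightarrow> 1 / weight m n ^ 2)"
        by (simp add: p)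
    qed simp
  qed
next
  assume c: "\<forall>k. (\<lambda>p. wt p ^ k * cmod (case_prod c p)) summable_on UNIV"
  show "rapidly_decreasing c" unfolding rapidly_decreasing_def
  proof
    fix k
    show "bdd_above (range (\<lambda>(m, n). weight m n ^ k * cmod (c m n)))"
    proof (rule bdd_aboveI2)
      fix p :: "int \<times> int"
      obtain m n where p: "p = (m, n)" by force
      have "weight m n ^ k * cmod (c m n) \<le> (wt p ^ 2) ^ k * cmod (c m n)"
        unfolding p using weight_ge_1[of m n]
        by (intro mult_right_mono power_mono weight_le_wt) auto
      also have "\<dots> = (\<Sum>p\<in>{p}. wt p ^ (2 * k) * cmod (case_prod c p))"
        by (simp add: p power_mult)
      also have "\<dots> \<le> (\<Sum>\<^sub>\<infinity>p. wt p ^ (2 * k) * cmod (case_prod c p))"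
        using c by (intro finite_sum_le_infsum) auto
      finally show "(case p of (m, n) \<Rightarrow> weight m n ^ k * cmod (c m n)) \<le>
          (\<Sum>\<^sub>\<infinity>p. wt p ^ (2 * k) * cmod (case_prod c p))" by (simp add: p)
    qed
  qed
qed

section \<open>Fourier coefficients\<close>

locale traced_rotation_algebra = irrational_rotation_algebra \<theta> U V + tracial \<tau>
  for \<theta> :: real and U V :: "'a::cstar_algebra" and \<tau> :: "'a \<Rightarrow> complex"
begin

definition W :: "int \<times> int \<Rightarrow> 'a" where
  "W p = upow U (fst p) * upow V (snd p)"

text \<open>The cocycle of the projective representation \<open>W\<close> of the lattice: see \<open>W_mult\<close> below.\<close>

definition twist :: "int \<times> int \<Rightarrow> int \<times> int \<Rightarrow> complex" where
  "twist p q = inverse (exp (2 * pi * \<i> * \<theta>)) powi (fst q * snd p)"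

lemma unitary_W: "unitary (W p)"
  by (simp add: W_def unitary_mult unitary_upow unitary_U unitary_V)

lemma W_0 [simp]: "W 0 = 1"
  by (simp add: W_def)

lemma cmod_twist [simp]: "cmod (twist p q) = 1"
  by (simp add: twist_def norm_power_int norm_inverse)

lemma cnj_twist [simp]: "twist p q * cnj (twist p q) = 1" "cnj (twist p q) * twist p q = 1"
  using complex_norm_square[of "twist p q"] by (simp_all add: mult.commute)

lemma W_mult: "W p * W q = twist p q *\<^sub>C W (p + q)"
proof -
  let ?r = "exp (2 * pi * \<i> * \<theta>) :: complex"
  have "V * U = inverse ?r *\<^sub>C (U * V)"
    by (simp add: commutation scaleC_scaleC)
  then have "upow V (snd p) * upow U (fst q)
      = (inverse ?r powi (fst q * snd p)) *\<^sub>C (upow U (fst q) * upow V (snd p))"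
    by (intro upow_mult_upow_commute unitary_U unitary_V) auto
  then have "upow U (fst p) * (upow V (snd p) * upow U (fst q)) * upow V (snd q)
     = twist p q *\<^sub>C ((upow U (fst p) * upow U (fst q)) * (upow V (snd p) * upow V (snd q)))"
    by (simp add: twist_def mult_scaleC_left mult_scaleC_right mult.assoc)
  then show ?thesis
    by (simp add: W_def upow_add unitary_U unitary_V mult.assoc)
qed

lemma star_W: "star (W p) = cnj (twist p (- p)) *\<^sub>C W (- p)"
proof -
  have "star (W p) * (W p * W (- p)) = W (- p)"
    using unitary_cancel[OF unitary_W] by simp
  then have "twist p (- p) *\<^sub>C star (W p) = W (- p)"
    by (simp add: W_mult mult_scaleC_right)
  then have "cnj (twist p (- p)) *\<^sub>C twist p (- p) *\<^sub>C star (W p) = cnj (twist p (- p)) *\<^sub>C W (- p)"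
    by simp
  then show ?thesis by (simp add: scaleC_scaleC)
qed

text \<open>
  \<open>W p\<close> is a product of two monomials that commute only up to a scalar, and the trace is invariant
  under exchanging them; that scalar is different from \<open>1\<close> because \<open>\<theta>\<close> is irrational.
\<close>

lemma trace_W: assumes "p \<noteq> 0" shows "\<tau> (W p) = 0"
proof -
  let ?l = "inverse (exp (2 * pi * \<i> * \<theta>)) :: complex"
  have ne: "?l powi k \<noteq> 1" if "k \<noteq> 0" for k
  proof
    assume "?l powi k = 1"
    then have "exp (2 * pi * \<i> * \<theta>) powi k = (1::complex)"
      by (simp add: power_int_inverse)
    then have "exp (of_int k * (2 * pi * \<i> * \<theta>)) = (1::complex)"
      by (simp add: exp_power_int mult.commute)
    then obtain n :: int where n: "of_int k * (2 * pi * \<theta>) = of_int (2 * n) * pi"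
      unfolding exp_eq_1 by auto
    then have "of_int k * \<theta> = of_int n" by simp
    then have "\<theta> = of_int n / of_int k" using that by (simp add: field_simps)
    then show False using irrational by (metis Rats_divide Rats_of_int)
  qed
  have eq: "twist q (p - q) * \<tau> (W p) = twist (p - q) q * \<tau> (W p)" for q
    using trace_commute[of "W q" "W (p - q)"] by (simp add: W_mult trace_scaleC)
  consider "fst p \<noteq> 0" | "snd p \<noteq> 0" using assms by (metis prod_eq_iff zero_prod_def fst_conv snd_conv)
  then show ?thesis
  proof cases
    case 1 then show ?thesis using eq[of "(0, 1)"] ne[of "fst p"] by (simp add: twist_def)
  next
    case 2 then show ?thesis using eq[of "(1, 0)"] ne[of "snd p"] by (simp add: twist_def)
  qed
qed

definition coef :: "'a \<Rightarrow> int \<times> int \<Rightarrow> complex" where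
  "coef a p = \<tau> (star (W p) * a)"

lemma bounded_linear_coef: "bounded_linear (\<lambda>a. coef a p)"
  unfolding coef_def
  by (intro bounded_linear_compose[OF bounded_linear_trace] bounded_linear_mult_right)

lemma coef_add: "coef (a + b) p = coef a p + coef b p"
  and coef_diff: "coef (a - b) p = coef a p - coef b p"
  and coef_minus: "coef (- a) p = - coef a p"
  and coef_scaleC: "coef (c *\<^sub>C a) p = c * coef a p"
  and coef_0: "coef a 0 = \<tau> a"
  by (simp_all add: coef_def distrib_left right_diff_distrib trace_add trace_diff trace_minus
      mult_scaleC_right trace_scaleC)

lemma coef_W: "coef (W q) p = (if p = q then 1 else 0)"
proof (cases "p = q")
  case True then show ?thesis using unitary_W[of p] by (simp add: coef_def unitary_def trace_one)
next
  case False
  then have "- p + q \<noteq> 0" by (simp add: add_eq_0_iff)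
  then show ?thesis using False
    by (simp add: coef_def star_W mult_scaleC_left W_mult trace_scaleC trace_W)
qed

lemma coef_one: "coef 1 p = (if p = 0 then 1 else 0)"
  using coef_W[of 0] by simp

text \<open>
  Uniqueness of Fourier coefficients: \<open>coef\<close> is continuous for the norm, so it can be applied to the
  series term by term.
\<close>

lemma coef_has_sum:
  assumes "((\<lambda>p. c p *\<^sub>C W p) has_sum a) UNIV" shows "coef a = c"
proof
  fix q
  have "((\<lambda>p. coef (c p *\<^sub>C W p) q) has_sum coef a q) UNIV"
    by (rule has_sum_bounded_linear[OF bounded_linear_coef assms])
  moreover have "((\<lambda>p. coef (c p *\<^sub>C W p) q) has_sum c q) UNIV"
    by (rule has_sum_finite_neutralI[of "{q}"]) (auto simp: coef_scaleC coef_W)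
  ultimately show "coef a q = c q" by (rule has_sum_unique)
qed

text \<open>
  An \<open>\<ell>\<^sup>1\<close>-norm in place of the supremum of the weighted coefficients: on smooth elements the family
  over \<open>k\<close> is equivalent to the given seminorms, and it is submultiplicative.
\<close>

definition wnorm :: "nat \<Rightarrow> 'a \<Rightarrow> real" where
  "wnorm k a = (\<Sum>\<^sub>\<infinity>p. wt p ^ k * cmod (coef a p))"

lemma has_expansion_iff:
  "has_expansion U V c a \<longleftrightarrow>
     (\<forall>k. (\<lambda>p. wt p ^ k * cmod (case_prod c p)) summable_on UNIV) \<and>
     ((\<lambda>p. case_prod c p *\<^sub>C W p) has_sum a) UNIV"
  by (simp add: has_expansion_def rapidly_decreasing_iff_summable W_def case_prod_unfold)

lemma has_expansion_imp_coef: "has_expansion U V c a \<Longrightarrow> c = curry (coef a)"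
  unfolding has_expansion_iff using coef_has_sum[of "case_prod c" a] by (simp add: curry_def)

lemma smooth_has_expansion:
  assumes "a \<in> smooth U V" shows "has_expansion U V (curry (coef a)) a"
proof -
  obtain c where "has_expansion U V c a" using assms by (auto simp: smooth_def)
  with has_expansion_imp_coef[OF this] show ?thesis by simp
qed

text \<open>
  Smoothness of \<open>a\<close> is not just decay of \<open>coef a\<close>: the series of these coefficients must also
  return \<open>a\<close>.
\<close>

lemma smooth_iff:
  "a \<in> smooth U V \<longleftrightarrow>
     (\<forall>k. (\<lambda>p. wt p ^ k * cmod (coef a p)) summable_on UNIV) \<and>
     ((\<lambda>p. coef a p *\<^sub>C W p) has_sum a) UNIV"
proof -
  have "a \<in> smooth U V \<longleftrightarrow> has_expansion U V (curry (coef a)) a"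
    using smooth_has_expansion by (auto simp: smooth_def)
  then show ?thesis by (simp add: has_expansion_iff)
qed

lemma smoothI:
  assumes "\<And>k. (\<lambda>p. wt p ^ k * cmod (c p)) summable_on UNIV"
    and "((\<lambda>p. c p *\<^sub>C W p) has_sum a) UNIV"
  shows "a \<in> smooth U V"
  using assms coef_has_sum[OF assms(2)] by (simp add: smooth_iff)

lemma fourier_coeff_eq: "a \<in> smooth U V \<Longrightarrow> fourier_coeff U V a m n = coef a (m, n)"
proof -
  assume "a \<in> smooth U V"
  then have "fourier_coeff U V a = curry (coef a)"
    unfolding fourier_coeff_def
    by (auto intro!: the_equality smooth_has_expansion dest: has_expansion_imp_coef)
  then show ?thesis by simp
qed

lemma smooth_summable: "a \<in> smooth U V \<Longrightarrow> (\<lambda>p. wt p ^ k * cmod (coef a p)) summable_on UNIV"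
  and smooth_has_sum: "a \<in> smooth U V \<Longrightarrow> ((\<lambda>p. coef a p *\<^sub>C W p) has_sum a) UNIV"
  by (auto simp: smooth_iff)

lemma smooth_eqI: "a \<in> smooth U V \<Longrightarrow> b \<in> smooth U V \<Longrightarrow> (\<And>p. coef a p = coef b p) \<Longrightarrow> a = b"
  using smooth_has_sum[of a] smooth_has_sum[of b] has_sum_unique[of "\<lambda>p. coef a p *\<^sub>C W p"] by simp

lemma wnorm_has_sum: "a \<in> smooth U V \<Longrightarrow> ((\<lambda>p. wt p ^ k * cmod (coef a p)) has_sum wnorm k a) UNIV"
  unfolding wnorm_def by (intro has_sum_infsum smooth_summable)

lemma wnorm_nonneg [simp]: "0 \<le> wnorm k a"
  unfolding wnorm_def by (intro infsum_nonneg) simp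

lemma norm_W [simp]: "norm (W p) = 1"
proof -
  have "(norm (W p))\<^sup>2 = 1\<^sup>2"
    using cstar_identity[of "W p"] unitary_W[of p] by (simp add: unitary_def)
  then show ?thesis by (simp only: power2_eq_iff_nonneg norm_ge_zero zero_le_one)
qed

lemma cmod_coef_le_wnorm: "a \<in> smooth U V \<Longrightarrow> cmod (coef a p) \<le> wnorm 0 a"
  using finite_sum_le_has_sum[OF wnorm_has_sum[of a 0], of "{p}"] by simp

section \<open>The algebra of smooth elements\<close>

lemma wnormI:
  assumes "a \<in> smooth U V" "((\<lambda>p. wt p ^ k * cmod (coef a p)) has_sum s) UNIV"
  shows "wnorm k a = s"
  using has_sum_unique[OF wnorm_has_sum[OF assms(1)] assms(2)] .

lemma smooth_scaleC: assumes "a \<in> smooth U V"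
  shows "c *\<^sub>C a \<in> smooth U V" "wnorm k (c *\<^sub>C a) = cmod c * wnorm k a"
proof -
  have 1: "((\<lambda>p. wt p ^ k * cmod (coef (c *\<^sub>C a) p)) has_sum cmod c * wnorm k a) UNIV" for k
    using has_sum_cmult_right[OF wnorm_has_sum[OF assms, of k], of "cmod c"]
    by (simp add: coef_scaleC norm_mult mult_ac)
  have 2: "((\<lambda>p. coef (c *\<^sub>C a) p *\<^sub>C W p) has_sum c *\<^sub>C a) UNIV"
    using has_sum_bounded_linear[OF bounded_linear_scaleC_right smooth_has_sum[OF assms], of c]
    by (simp add: coef_scaleC scaleC_scaleC)
  show "c *\<^sub>C a \<in> smooth U V"
    unfolding smooth_iff using 1 2 has_sum_imp_summable by blast
  then show "wnorm k (c *\<^sub>C a) = cmod c * wnorm k a" by (rule wnormI[OF _ 1])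
qed

lemma smooth_add: assumes a: "a \<in> smooth U V" and b: "b \<in> smooth U V"
  shows "a + b \<in> smooth U V" "wnorm k (a + b) \<le> wnorm k a + wnorm k b"
proof -
  have le: "wt p ^ k * cmod (coef (a + b) p) \<le> wt p ^ k * cmod (coef a p) + wt p ^ k * cmod (coef b p)"
    for p k
    using mult_left_mono[OF norm_triangle_ineq[of "coef a p" "coef b p"], of "wt p ^ k"]
    by (simp add: coef_add distrib_left)
  have s: "((\<lambda>p. wt p ^ k * cmod (coef a p) + wt p ^ k * cmod (coef b p))
      has_sum wnorm k a + wnorm k b) UNIV" for k
    by (intro has_sum_add wnorm_has_sum a b)
  have 1: "(\<lambda>p. wt p ^ k * cmod (coef (a + b) p)) summable_on UNIV" for k
    using has_sum_imp_summable[OF s] le by (rule summable_on_comparison_test) simp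
  have "((\<lambda>p. coef (a + b) p *\<^sub>C W p) has_sum a + b) UNIV"
    using has_sum_add[OF smooth_has_sum[OF a] smooth_has_sum[OF b]]
    by (simp add: coef_add scaleC_add_left)
  with 1 show "a + b \<in> smooth U V" unfolding smooth_iff by blast
  then show "wnorm k (a + b) \<le> wnorm k a + wnorm k b"
    using wnorm_has_sum s le by (intro has_sum_mono[OF wnorm_has_sum s])
qed

lemma smooth_minus: assumes "a \<in> smooth U V"
  shows "- a \<in> smooth U V" "wnorm k (- a) = wnorm k a"
  using smooth_scaleC[OF assms, where c = "- 1"] by (simp_all add: scaleC_minus_left)

lemma smooth_diff: assumes a: "a \<in> smooth U V" and b: "b \<in> smooth U V"
  shows "a - b \<in> smooth U V" "wnorm k (a - b) \<le> wnorm k a + wnorm k b"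
  using smooth_add[OF a smooth_minus(1)[OF b]] smooth_minus(2)[OF b] by simp_all

lemma smooth_W: "W q \<in> smooth U V" "wnorm k (W q) = wt q ^ k"
proof -
  have 1: "((\<lambda>p. wt p ^ k * cmod (coef (W q) p)) has_sum wt q ^ k) UNIV" for k
    by (rule has_sum_finite_neutralI[of "{q}"]) (auto simp: coef_W)
  have 2: "((\<lambda>p. coef (W q) p *\<^sub>C W p) has_sum W q) UNIV"
    by (rule has_sum_finite_neutralI[of "{q}"]) (auto simp: coef_W)
  show "W q \<in> smooth U V" using 1 2 has_sum_imp_summable unfolding smooth_iff by blast
  then show "wnorm k (W q) = wt q ^ k" by (rule wnormI[OF _ 1])
qed

lemma smooth_one: "1 \<in> smooth U V" "wnorm k 1 = 1"
  using smooth_W[where q = 0] by (simp_all add: wt_def)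

lemma smooth_star: assumes "a \<in> smooth U V"
  shows "star a \<in> smooth U V" "wnorm k (star a) = wnorm k a"
    and "coef (star a) p = cnj (coef a (- p) * twist (- p) p)"
proof -
  let ?c = "\<lambda>p. cnj (coef a (- p) * twist (- p) p)"
  have "((\<lambda>p. star (coef a p *\<^sub>C W p)) has_sum star a) UNIV"
    by (rule has_sum_bounded_linear[OF bounded_linear_star smooth_has_sum[OF assms]])
  also have "(\<lambda>p. star (coef a p *\<^sub>C W p)) = (\<lambda>p. ?c (- p) *\<^sub>C W (- p))"
    by (simp add: star_scaleC star_W scaleC_scaleC)
  also have "((\<lambda>p. ?c (- p) *\<^sub>C W (- p)) has_sum star a) UNIV
      \<longleftrightarrow> ((\<lambda>p. ?c p *\<^sub>C W p) has_sum star a) UNIV"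
    by (rule has_sum_reindex_bij_witness[of _ uminus uminus]) auto
  finally have s: "((\<lambda>p. ?c p *\<^sub>C W p) has_sum star a) UNIV" .
  have coef: "coef (star a) = ?c" by (rule coef_has_sum[OF s])
  have "wt (- p) = wt p" for p by (simp add: wt_def)
  then have "((\<lambda>p. wt p ^ k * cmod (coef (star a) p)) has_sum wnorm k a) UNIV
      \<longleftrightarrow> ((\<lambda>p. wt p ^ k * cmod (coef a p)) has_sum wnorm k a) UNIV" for k
    unfolding coef
    by (intro has_sum_reindex_bij_witness[of _ uminus uminus]) (auto simp: norm_mult)
  then have w: "((\<lambda>p. wt p ^ k * cmod (coef (star a) p)) has_sum wnorm k a) UNIV" for k
    using wnorm_has_sum[OF assms] by blast
  show "coef (star a) p = ?c p" by (simp add: coef)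
  have "((\<lambda>p. coef (star a) p *\<^sub>C W p) has_sum star a) UNIV" unfolding coef by (rule s)
  with w show "star a \<in> smooth U V" unfolding smooth_iff using has_sum_imp_summable by blast
  then show "wnorm k (star a) = wnorm k a" by (rule wnormI[OF _ w])
qed

text \<open>
  Completeness of the smooth subalgebra in the weighted norms: the double series of Fourier
  coefficients converges absolutely, so that the two summations can be exchanged. Both products and
  exponentials of smooth elements are sums of such series.
\<close>

lemma smooth_series:
  fixes f :: "'i \<Rightarrow> 'a"
  assumes f: "\<And>i. f i \<in> smooth U V"
    and b: "\<And>k i. wnorm k (f i) \<le> b k i" and bs: "\<And>k. (b k has_sum B k) UNIV"
    and a: "(f has_sum a) UNIV"
  shows "a \<in> smooth U V" "wnorm k a \<le> B k"
proof -
  have sw: "(\<lambda>i. wnorm k (f i)) summable_on UNIV" for k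
    using has_sum_imp_summable[OF bs] b by (rule summable_on_comparison_test) simp
  have sB: "(\<Sum>\<^sub>\<infinity>i. wnorm k (f i)) \<le> B k" for k
    using sw b bs by (intro has_sum_mono[OF has_sum_infsum[OF sw] bs]) auto
  have pair: "(\<lambda>(i, p). wt p ^ k * cmod (coef (f i) p)) summable_on UNIV \<times> UNIV" for k
    by (rule summable_on_SigmaI[OF _ sw[of k]]) (auto simp: wnorm_has_sum f)
  have pair': "((\<lambda>(p, i). wt p ^ k * cmod (coef (f i) p))
      has_sum (\<Sum>\<^sub>\<infinity>i. wnorm k (f i))) (UNIV \<times> UNIV)" for k
  proof -
    have "((\<lambda>(i, p). wt p ^ k * cmod (coef (f i) p)) has_sum (\<Sum>\<^sub>\<infinity>i. wnorm k (f i))) (UNIV \<times> UNIV)"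
      by (rule has_sum_SigmaI[OF _ has_sum_infsum[OF sw[of k]] pair[of k]]) (auto simp: wnorm_has_sum f)
    then show ?thesis by (subst (asm) has_sum_swap) (simp add: case_prod_unfold)
  qed
  have col: "((\<lambda>i. coef (f i) p) has_sum coef a p) UNIV" for p
    by (rule has_sum_bounded_linear[OF bounded_linear_coef a])
  have abs_col: "(\<lambda>i. wt p ^ k * cmod (coef (f i) p)) summable_on UNIV" for p k
    using summable_on_SigmaD1[OF has_sum_imp_summable[OF pair'], of p k] by simp
  define g where "g k p = (\<Sum>\<^sub>\<infinity>i. wt p ^ k * cmod (coef (f i) p))" for k p
  have g: "(g k has_sum (\<Sum>\<^sub>\<infinity>i. wnorm k (f i))) UNIV" for k
    by (rule has_sum_SigmaD[OF pair']) (simp add: g_def has_sum_infsum[OF abs_col])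
  \<comment> \<open>The weight is moved inside the modulus so that the triangle inequality applies to the sum.\<close>
  have le: "wt p ^ k * cmod (coef a p) \<le> g k p" for k p
  proof -
    have "((\<lambda>i. complex_of_real (wt p ^ k) * coef (f i) p) has_sum complex_of_real (wt p ^ k) * coef a p) UNIV"
      by (rule has_sum_cmult_right[OF col])
    moreover have "((\<lambda>i. wt p ^ k * cmod (coef (f i) p)) has_sum g k p) UNIV"
      unfolding g_def by (rule has_sum_infsum[OF abs_col])
    ultimately have "cmod (complex_of_real (wt p ^ k) * coef a p) \<le> g k p"
      by (rule norm_infsum_le) (simp add: norm_mult norm_power)
    then show ?thesis by (simp add: norm_mult norm_power)
  qed
  have 1: "(\<lambda>p. wt p ^ k * cmod (coef a p)) summable_on UNIV" for k
    using has_sum_imp_summable[OF g] le by (rule summable_on_comparison_test) simp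
  have "(\<lambda>(i, p). coef (f i) p *\<^sub>C W p) summable_on UNIV \<times> UNIV"
    using pair[of 0] by - (rule abs_summable_summable, simp add: case_prod_unfold norm_scaleC)
  then have "((\<lambda>(i, p). coef (f i) p *\<^sub>C W p) has_sum a) (UNIV \<times> UNIV)"
    by (intro has_sum_SigmaI[OF _ a]) (auto simp: smooth_has_sum f)
  then have "((\<lambda>(p, i). coef (f i) p *\<^sub>C W p) has_sum a) (UNIV \<times> UNIV)"
    by (subst (asm) has_sum_swap) (simp add: case_prod_unfold)
  then have 2: "((\<lambda>p. coef a p *\<^sub>C W p) has_sum a) UNIV"
    by (rule has_sum_SigmaD) (simp add: has_sum_bounded_linear[OF bounded_linear_scaleC_left col])
  show "a \<in> smooth U V" using 1 2 unfolding smooth_iff by blast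
  then have "wnorm k a \<le> (\<Sum>\<^sub>\<infinity>i. wnorm k (f i))"
    using le by (intro has_sum_mono[OF wnorm_has_sum g])
  then show "wnorm k a \<le> B k" using sB[of k] by simp
qed

lemma coef_W_mult: "coef (W q * a) p = twist q (p - q) * coef a (p - q)"
proof -
  have "star (W p) * W q = star (star (W q) * W p)" by (simp add: star_mult star_star)
  also have "star (W q) * W p = cnj (twist q (p - q)) *\<^sub>C star (W q) * (twist q (p - q) *\<^sub>C W p)"
    by (simp add: mult_scaleC_left mult_scaleC_right scaleC_scaleC)
  also have "twist q (p - q) *\<^sub>C W p = W q * W (p - q)" by (simp add: W_mult)
  also have "cnj (twist q (p - q)) *\<^sub>C star (W q) * (W q * W (p - q))
      = cnj (twist q (p - q)) *\<^sub>C W (p - q)"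
    using unitary_cancel[OF unitary_W] by (simp add: mult_scaleC_left)
  finally show ?thesis
    by (simp add: coef_def mult.assoc[symmetric] star_scaleC mult_scaleC_left trace_scaleC)
qed

lemma smooth_W_mult: assumes a: "a \<in> smooth U V"
  shows "W q * a \<in> smooth U V" "wnorm k (W q * a) \<le> wt q ^ k * wnorm k a"
proof -
  have s: "((\<lambda>p. wt q ^ k * (wt (p - q) ^ k * cmod (coef a (p - q)))) has_sum wt q ^ k * wnorm k a) UNIV
     \<longleftrightarrow> ((\<lambda>p. wt q ^ k * (wt p ^ k * cmod (coef a p))) has_sum wt q ^ k * wnorm k a) UNIV" for k
    by (rule has_sum_reindex_bij_witness[of _ "\<lambda>p. p + q" "\<lambda>p. p - q"]) auto
  have s: "((\<lambda>p. wt q ^ k * (wt (p - q) ^ k * cmod (coef a (p - q)))) has_sum wt q ^ k * wnorm k a) UNIV" for k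
    unfolding s by (rule has_sum_cmult_right[OF wnorm_has_sum[OF a]])
  have le: "wt p ^ k * cmod (coef (W q * a) p) \<le> wt q ^ k * (wt (p - q) ^ k * cmod (coef a (p - q)))"
    for p k
    using power_mono[OF wt_add_le[of q "p - q"], of k] mult_right_mono[of "wt p ^ k" "(wt q * wt (p - q)) ^ k" "cmod (coef a (p - q))"]
    by (simp add: coef_W_mult norm_mult power_mult_distrib mult.assoc)
  have 1: "(\<lambda>p. wt p ^ k * cmod (coef (W q * a) p)) summable_on UNIV" for k
    using has_sum_imp_summable[OF s] le by (rule summable_on_comparison_test) simp
  have "((\<lambda>p. W q * (coef a p *\<^sub>C W p)) has_sum W q * a) UNIV"
    by (rule has_sum_bounded_linear[OF bounded_linear_mult_right smooth_has_sum[OF a]])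
  also have "((\<lambda>p. W q * (coef a p *\<^sub>C W p)) has_sum W q * a) UNIV
      \<longleftrightarrow> ((\<lambda>p. coef (W q * a) p *\<^sub>C W p) has_sum W q * a) UNIV"
    by (rule has_sum_reindex_bij_witness[of _ "\<lambda>p. p - q" "\<lambda>p. p + q"])
       (auto simp: coef_W_mult mult_scaleC_right W_mult scaleC_scaleC mult.commute add.commute)
  finally show "W q * a \<in> smooth U V" using 1 unfolding smooth_iff by blast
  then show "wnorm k (W q * a) \<le> wt q ^ k * wnorm k a"
    using le by (intro has_sum_mono[OF wnorm_has_sum s])
qed

lemma mult_has_sum: assumes "a \<in> smooth U V"
  shows "((\<lambda>q. coef a q *\<^sub>C (W q * b)) has_sum a * b) UNIV"
  using has_sum_bounded_linear[OF bounded_linear_mult_left smooth_has_sum[OF assms], of b]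
  by (simp add: mult_scaleC_left)

text \<open>The product is the series of the elements \<open>coef a q *\<^sub>C (W q * b)\<close>.\<close>

lemma smooth_mult: assumes a: "a \<in> smooth U V" and b: "b \<in> smooth U V"
  shows "a * b \<in> smooth U V" "wnorm k (a * b) \<le> wnorm k a * wnorm k b"
proof -
  have le: "wnorm k (coef a q *\<^sub>C (W q * b)) \<le> wt q ^ k * cmod (coef a q) * wnorm k b" for k q
    using mult_left_mono[OF smooth_W_mult(2)[OF b, where k = k and q = q], of "cmod (coef a q)"]
    by (simp add: smooth_scaleC smooth_W_mult b mult_ac)
  have s: "((\<lambda>q. wt q ^ k * cmod (coef a q) * wnorm k b) has_sum wnorm k a * wnorm k b) UNIV" for k
    by (rule has_sum_cmult_left[OF wnorm_has_sum[OF a]])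
  note smooth_series[OF _ le s mult_has_sum[OF a]]
  then show "a * b \<in> smooth U V" "wnorm k (a * b) \<le> wnorm k a * wnorm k b"
    by (auto simp: smooth_scaleC smooth_W_mult b)
qed

lemma coef_mult_has_sum: assumes "a \<in> smooth U V"
  shows "((\<lambda>q. coef a q * (twist q (p - q) * coef b (p - q))) has_sum coef (a * b) p) UNIV"
  using has_sum_bounded_linear[OF bounded_linear_coef[of p] mult_has_sum[OF assms, of b]]
  by (simp add: coef_scaleC coef_W_mult)

lemma smooth_power: assumes a: "a \<in> smooth U V"
  shows "a ^ n \<in> smooth U V" "wnorm k (a ^ n) \<le> wnorm k a ^ n"
proof -
  have "a ^ n \<in> smooth U V \<and> (\<forall>k. wnorm k (a ^ n) \<le> wnorm k a ^ n)"
  proof (induct n)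
    case (Suc n)
    have "wnorm k (a * a ^ n) \<le> wnorm k a * wnorm k a ^ n" for k
      using smooth_mult(2)[OF a, where b = "a ^ n"] Suc
      by (meson mult_left_mono order_trans wnorm_nonneg)
    then show ?case using Suc smooth_mult(1)[OF a] by simp
  qed (simp add: smooth_one)
  then show "a ^ n \<in> smooth U V" "wnorm k (a ^ n) \<le> wnorm k a ^ n" by auto
qed

text \<open>
  Taylor's formula: \<open>y\<close> is the power series \<open>\<Sum>n. x\<^sup>n / (n + 2)!\<close>, dominated by that of \<open>exp\<close>.
\<close>

lemma smooth_exp_Taylor: assumes x: "x \<in> smooth U V"
  obtains y where "y \<in> smooth U V" "\<And>k. wnorm k y \<le> exp (wnorm k x)"
    "exp x = 1 + x + x * x * y"
proof -
  have fact_le: "inverse (fact (n + 2)) \<le> (inverse (fact n) :: real)" for n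
    by (intro le_imp_inverse_le fact_mono) auto
  define f where "f n = (inverse (fact (n + 2)) :: real) *\<^sub>R x ^ n" for n
  define b where "b k n = inverse (fact n) * wnorm k x ^ n" for k n
  have "(\<lambda>n. inverse (fact n) *\<^sub>R wnorm k x ^ n) sums exp (wnorm k x)" for k
    by (rule exp_converges)
  then have b: "(b k has_sum exp (wnorm k x)) UNIV" for k
    by (intro sums_nonneg_imp_has_sum) (simp_all add: b_def[abs_def])
  have norm_le: "norm (f n) \<le> inverse (fact n) * norm x ^ n" for n
    unfolding f_def norm_scaleR
    using fact_le[of n] by (intro mult_mono) (auto simp: norm_power_ineq simp del: fact_Suc)
  have fs: "summable (\<lambda>n. norm (f n))"
    by (rule summable_comparison_test'[where N = 0, OF summable_exp[of "norm x"]]) (simp add: norm_le)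
  define y where "y = suminf f"
  have fy: "f sums y" unfolding y_def by (rule summable_sums[OF summable_norm_cancel[OF fs]])
  then have y: "(f has_sum y) UNIV" by (intro norm_summable_imp_has_sum fs)
  have f_sm: "f n \<in> smooth U V" for n
    by (simp add: f_def scaleR_scaleC smooth_scaleC smooth_power x)
  have f_le: "wnorm k (f n) \<le> b k n" for k n
  proof -
    have "wnorm k (f n) = inverse (fact (n + 2)) * wnorm k (x ^ n)"
      by (simp add: f_def scaleR_scaleC smooth_scaleC smooth_power x norm_inverse del: fact_Suc)
    also have "\<dots> \<le> b k n" unfolding b_def
      using fact_le[of n] by (intro mult_mono smooth_power x) auto
    finally show ?thesis .
  qed
  have "exp x = 1 + x + x * x * y"
  proof -
    have "(\<lambda>n. x * x * f n) sums (x * x * y)" by (rule sums_mult[OF fy])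
    moreover have "x * x * f n = inverse (fact (n + 2)) *\<^sub>R x ^ (n + 2)" for n
      by (simp add: f_def power_add power2_eq_square power_commutes mult.assoc del: fact_Suc)
    ultimately have "(\<lambda>n. inverse (fact (n + 2)) *\<^sub>R x ^ (n + 2)) sums (x * x * y)" by simp
    then have "(\<lambda>n. inverse (fact n) *\<^sub>R x ^ n) sums (x * x * y + (\<Sum>n<2. inverse (fact n) *\<^sub>R x ^ n))"
      by (subst (asm) sums_iff_shift)
    moreover have "(\<lambda>n. inverse (fact n) *\<^sub>R x ^ n) sums exp x" by (rule exp_converges)
    ultimately show ?thesis by (simp add: sums_unique2 numeral_2_eq_2 add_ac sums_iff)
  qed
  then show ?thesis using that smooth_series[OF f_sm f_le b y] by blast
qed

end

section \<open>The coordinate derivations\<close>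

text \<open>One proof for an unspecified coordinate serves both generators.\<close>

definition coordinate :: "(int \<times> int \<Rightarrow> int) \<Rightarrow> bool" where
  "coordinate \<phi> \<longleftrightarrow> \<phi> = fst \<or> \<phi> = snd"

lemma coordinate_simps [simp]: "coordinate fst" "coordinate snd"
  by (simp_all add: coordinate_def)

lemma coordinate_add: "coordinate \<phi> \<Longrightarrow> \<phi> (p + q) = \<phi> p + \<phi> q"
  and coordinate_minus: "coordinate \<phi> \<Longrightarrow> \<phi> (- p) = - \<phi> p"
  and coordinate_0: "coordinate \<phi> \<Longrightarrow> \<phi> 0 = 0"
  and coordinate_le_wt: "coordinate \<phi> \<Longrightarrow> \<bar>real_of_int (\<phi> p)\<bar> \<le> wt p"
  by (auto simp: coordinate_def wt_def)

context traced_rotation_algebra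
begin

text \<open>The derivation \<open>\<delta>\<close> of the respective coordinate, divided by \<open>2\<pi>i\<close>: see \<open>delta_eq_der\<close> below.\<close>

definition der :: "(int \<times> int \<Rightarrow> int) \<Rightarrow> 'a \<Rightarrow> 'a" where
  "der \<phi> a = (\<Sum>\<^sub>\<infinity>p. (of_int (\<phi> p) * coef a p) *\<^sub>C W p)"

context
  fixes \<phi> assumes \<phi>: "coordinate \<phi>"
begin

lemma der_smooth: assumes a: "a \<in> smooth U V"
  shows "der \<phi> a \<in> smooth U V" "coef (der \<phi> a) p = of_int (\<phi> p) * coef a p"
    "wnorm k (der \<phi> a) \<le> wnorm (Suc k) a"
proof -
  have le: "wt p ^ k * cmod (of_int (\<phi> p) * coef a p) \<le> wt p ^ Suc k * cmod (coef a p)" for p k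
    using mult_right_mono[OF coordinate_le_wt[OF \<phi>, of p], of "wt p ^ k * cmod (coef a p)"]
    by (simp add: norm_mult mult_ac)
  have s: "(\<lambda>p. wt p ^ k * cmod (of_int (\<phi> p) * coef a p)) summable_on UNIV" for k
    using smooth_summable[OF a, of "Suc k"] le by (rule summable_on_comparison_test) simp
  have "(\<lambda>p. (of_int (\<phi> p) * coef a p) *\<^sub>C W p) summable_on UNIV"
    by (rule abs_summable_summable) (use s[of 0] in \<open>simp add: norm_scaleC\<close>)
  then have d: "((\<lambda>p. (of_int (\<phi> p) * coef a p) *\<^sub>C W p) has_sum der \<phi> a) UNIV"
    unfolding der_def by (rule has_sum_infsum)
  then show sm: "der \<phi> a \<in> smooth U V" by (intro smoothI[OF s])
  show c: "coef (der \<phi> a) p = of_int (\<phi> p) * coef a p" for p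
    using coef_has_sum[OF d] by simp
  show "wnorm k (der \<phi> a) \<le> wnorm (Suc k) a"
    by (rule has_sum_mono[OF wnorm_has_sum[OF sm] wnorm_has_sum[OF a, of "Suc k"]])
       (use le in \<open>simp add: c\<close>)
qed

lemma der_scaleC: "a \<in> smooth U V \<Longrightarrow> der \<phi> (c *\<^sub>C a) = c *\<^sub>C der \<phi> a"
  by (rule smooth_eqI) (simp_all add: der_smooth smooth_scaleC coef_scaleC)

lemma der_add: "a \<in> smooth U V \<Longrightarrow> b \<in> smooth U V \<Longrightarrow> der \<phi> (a + b) = der \<phi> a + der \<phi> b"
  by (rule smooth_eqI) (simp_all add: der_smooth smooth_add coef_add distrib_left)

lemma der_diff: "a \<in> smooth U V \<Longrightarrow> b \<in> smooth U V \<Longrightarrow> der \<phi> (a - b) = der \<phi> a - der \<phi> b"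
  by (rule smooth_eqI) (simp_all add: der_smooth smooth_diff coef_diff right_diff_distrib)

lemma der_one: "der \<phi> 1 = 0"
  by (simp add: der_def coef_one coordinate_0[OF \<phi>] if_distrib cong: if_cong)

lemma der_W: "der \<phi> (W q) = of_int (\<phi> q) *\<^sub>C W q"
  by (rule smooth_eqI) (simp_all add: der_smooth smooth_scaleC smooth_W coef_scaleC coef_W)

lemma der_star: "a \<in> smooth U V \<Longrightarrow> der \<phi> (star a) = - star (der \<phi> a)"
  by (rule smooth_eqI)
     (simp_all add: der_smooth smooth_star smooth_minus coef_minus coordinate_minus[OF \<phi>])

lemma trace_der: "a \<in> smooth U V \<Longrightarrow> \<tau> (der \<phi> a) = 0"
  using der_smooth(2)[of a 0] by (simp add: coef_0 coordinate_0[OF \<phi>])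

text \<open>
  The Leibniz rule: the coefficient of a product at \<open>p\<close> is a twisted convolution over \<open>p = q + (p - q)\<close>,
  and \<open>\<phi>\<close> is additive.
\<close>

lemma der_mult: assumes a: "a \<in> smooth U V" and b: "b \<in> smooth U V"
  shows "der \<phi> (a * b) = der \<phi> a * b + a * der \<phi> b"
proof (rule smooth_eqI)
  fix p
  have "((\<lambda>q. of_int (\<phi> p) * (coef a q * (twist q (p - q) * coef b (p - q))))
      has_sum of_int (\<phi> p) * coef (a * b) p) UNIV"
    by (rule has_sum_cmult_right[OF coef_mult_has_sum[OF a]])
  moreover have "((\<lambda>q. coef (der \<phi> a) q * (twist q (p - q) * coef b (p - q))
        + coef a q * (twist q (p - q) * coef (der \<phi> b) (p - q)))
      has_sum coef (der \<phi> a * b) p + coef (a * der \<phi> b) p) UNIV"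
    by (intro has_sum_add coef_mult_has_sum a der_smooth)
  moreover have "coef (der \<phi> a) q * (twist q (p - q) * coef b (p - q))
        + coef a q * (twist q (p - q) * coef (der \<phi> b) (p - q))
      = of_int (\<phi> p) * (coef a q * (twist q (p - q) * coef b (p - q)))" for q
  proof -
    have "\<phi> p = \<phi> q + \<phi> (p - q)" using coordinate_add[OF \<phi>, of q "p - q"] by simp
    then show ?thesis by (simp add: der_smooth a b algebra_simps)
  qed
  ultimately show "coef (der \<phi> (a * b)) p = coef (der \<phi> a * b + a * der \<phi> b) p"
    using has_sum_unique by (simp add: der_smooth smooth_mult a b coef_add) blast
qed (simp_all add: der_smooth smooth_mult smooth_add a b)

end

lemma der_commute: "coordinate \<phi> \<Longrightarrow> coordinate \<psi> \<Longrightarrow> a \<in> smooth U V \<Longrightarrow>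
    der \<phi> (der \<psi> a) = der \<psi> (der \<phi> a)"
  by (rule smooth_eqI) (simp_all add: der_smooth mult_ac)

section \<open>Parseval's identity and the energy\<close>

lemma Parseval: assumes a: "a \<in> smooth U V"
  shows "((\<lambda>p. (cmod (coef a p))\<^sup>2) has_sum (norm2 a)\<^sup>2) UNIV"
proof -
  have "((\<lambda>p. \<tau> (star a * (coef a p *\<^sub>C W p))) has_sum \<tau> (star a * a)) UNIV"
    by (intro has_sum_bounded_linear[OF bounded_linear_trace]
        has_sum_bounded_linear[OF bounded_linear_mult_right] smooth_has_sum a)
  moreover have "\<tau> (star a * (coef a p *\<^sub>C W p)) = complex_of_real ((cmod (coef a p))\<^sup>2)" for p
    using trace_star[of "star (W p) * a"]
    by (simp add: mult_scaleC_right trace_scaleC coef_def star_mult star_star complex_norm_square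
        del: of_real_power)
  ultimately show ?thesis by (simp add: norm2_square_complex[symmetric] has_sum_of_real_iff del: of_real_power)
qed

text \<open>On smooth elements the trace is faithful, by Parseval's identity.\<close>

lemma norm2_eq_0_iff: "a \<in> smooth U V \<Longrightarrow> norm2 a = 0 \<longleftrightarrow> a = 0"
proof
  assume a: "a \<in> smooth U V" and "norm2 a = 0"
  have "coef a p = 0" for p
    using finite_sum_le_has_sum[OF Parseval[OF a], of "{p}"] \<open>norm2 a = 0\<close> by simp
  then have "((\<lambda>p. 0) has_sum a) (UNIV :: (int \<times> int) set)" using smooth_has_sum[OF a] by simp
  then show "a = 0" using has_sum_unique has_sum_0_simp by blast
qed (simp add: norm2_def trace_zero)

lemma norm2_unitary: "unitary u \<Longrightarrow> norm2 u = 1"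
  by (simp add: norm2_def unitary_def trace_one)

text \<open>
  Left multiplication by each \<open>W q\<close> preserves \<^const>\<open>norm2\<close>. For the infinite sum, put \<open>y = a x\<close> and
  estimate \<open>\<tau> (y\<^sup>* y)\<close> term by term; one factor \<open>norm2 y\<close> then cancels.
\<close>

lemma norm2_mult_le: assumes a: "a \<in> smooth U V"
  shows "norm2 (a * x) \<le> wnorm 0 a * norm2 x"
proof -
  define y where "y = a * x"
  have "((\<lambda>q. \<tau> (star y * (coef a q *\<^sub>C (W q * x)))) has_sum \<tau> (star y * y)) UNIV"
    unfolding y_def
    by (intro has_sum_bounded_linear[OF bounded_linear_trace]
        has_sum_bounded_linear[OF bounded_linear_mult_right] mult_has_sum a)
  moreover have "((\<lambda>q. wt q ^ 0 * cmod (coef a q) * (norm2 y * norm2 x))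
      has_sum wnorm 0 a * (norm2 y * norm2 x)) UNIV"
    by (rule has_sum_cmult_left[OF wnorm_has_sum[OF a]])
  ultimately have "cmod (\<tau> (star y * y)) \<le> wnorm 0 a * (norm2 y * norm2 x)"
  proof (rule norm_infsum_le)
    fix q
    have "cmod (\<tau> (star y * (W q * x))) \<le> norm2 y * norm2 x"
      using trace_Cauchy_Schwarz[of y "W q * x"] norm2_unitary_mult[OF unitary_W] by simp
    then show "cmod (\<tau> (star y * (coef a q *\<^sub>C (W q * x)))) \<le> wt q ^ 0 * cmod (coef a q) * (norm2 y * norm2 x)"
      by (simp add: mult_scaleC_right trace_scaleC norm_mult mult_left_mono)
  qed
  then have "norm2 y * norm2 y \<le> norm2 y * (wnorm 0 a * norm2 x)"
    by (simp add: norm2_square_complex[symmetric] power2_eq_square norm_mult mult_ac del: of_real_power)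
  then show ?thesis
    using norm2_nonneg[of y]
    by (cases "norm2 y = 0") (auto simp: y_def[symmetric] mult_le_cancel_left)
qed

lemma norm2_le_wnorm: "a \<in> smooth U V \<Longrightarrow> norm2 a \<le> wnorm 0 a"
  using norm2_mult_le[of a 1] norm2_unitary[of 1] by (simp add: unitary_def)

lemma delta_eq_der: assumes a: "a \<in> smooth U V"
  shows "\<delta>\<^sub>1 U V a = (2 * pi * \<i>) *\<^sub>C der fst a" "\<delta>\<^sub>2 U V a = (2 * pi * \<i>) *\<^sub>C der snd a"
proof -
  have "((\<lambda>p. (2 * pi * \<i>) *\<^sub>C (coef (der \<phi> a) p *\<^sub>C W p)) has_sum (2 * pi * \<i>) *\<^sub>C der \<phi> a) UNIV"
    if "coordinate \<phi>" for \<phi>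
    by (intro has_sum_bounded_linear[OF bounded_linear_scaleC_right] smooth_has_sum der_smooth a that)
  then have *: "(\<Sum>\<^sub>\<infinity>p. (2 * pi * \<i> * of_int (\<phi> p) * coef a p) *\<^sub>C W p) = (2 * pi * \<i>) *\<^sub>C der \<phi> a"
    if "coordinate \<phi>" for \<phi>
    using that by (intro infsumI) (simp add: der_smooth a scaleC_scaleC mult.assoc)
  show "\<delta>\<^sub>1 U V a = (2 * pi * \<i>) *\<^sub>C der fst a" "\<delta>\<^sub>2 U V a = (2 * pi * \<i>) *\<^sub>C der snd a"
    using *[of fst] *[of snd] by (simp_all add: \<delta>\<^sub>1_def \<delta>\<^sub>2_def fourier_coeff_eq a case_prod_unfold W_def)
qed

lemma energy_eq: assumes a: "a \<in> smooth U V"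
  shows "energy U V \<tau> a = 2 * pi\<^sup>2 * ((norm2 (der fst a))\<^sup>2 + (norm2 (der snd a))\<^sup>2)"
proof -
  have "Re (\<tau> (star ((2 * pi * \<i>) *\<^sub>C b) * ((2 * pi * \<i>) *\<^sub>C b))) = 4 * pi\<^sup>2 * (norm2 b)\<^sup>2" for b
    unfolding norm2_square[symmetric] norm2_scaleC
    by (simp add: norm_mult power_mult_distrib)
  then show ?thesis
    by (simp add: energy_def delta_eq_der a trace_add algebra_simps)
qed

section \<open>The first variation of the energy\<close>

lemma has_derivative_of_quadratic_bound:
  fixes f :: "real \<Rightarrow> real"
  assumes "\<And>t. \<bar>t\<bar> \<le> 1 \<Longrightarrow> \<bar>f t - f 0 - D * t\<bar> \<le> K * t\<^sup>2"
  shows "(f has_real_derivative D) (at 0)"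
proof -
  have "((\<lambda>t. (f (0 + t) - f 0) / t - D) \<longlongrightarrow> 0) (at 0)"
  proof (rule Lim_null_comparison)
    show "((\<lambda>t. K * \<bar>t\<bar>) \<longlongrightarrow> 0) (at 0)"
      by (auto intro!: tendsto_eq_intros)
    have "norm ((f (0 + t) - f 0) / t - D) \<le> K * \<bar>t\<bar>" if "t \<noteq> 0" "dist t 0 < 1" for t
    proof -
      have "norm ((f (0 + t) - f 0) / t - D) = \<bar>f t - f 0 - D * t\<bar> / \<bar>t\<bar>"
        using that unfolding real_norm_def by (subst abs_divide[symmetric]) (simp add: diff_divide_distrib)
      also have "\<dots> \<le> K * t\<^sup>2 / \<bar>t\<bar>"
        using that assms[of t] by (intro divide_right_mono) auto
      also have "\<dots> = K * \<bar>t\<bar>"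
        using that by (simp add: power2_eq_square abs_if field_simps)
      finally show ?thesis .
    qed
    then show "\<forall>\<^sub>F t in at 0. norm ((f (0 + t) - f 0) / t - D) \<le> K * \<bar>t\<bar>"
      by (auto simp: eventually_at intro!: exI[of _ 1])
  qed
  then show ?thesis unfolding DERIV_def by (rule LIM_zero_cancel)
qed

text \<open>
  The coefficient \<open>y t\<close> of \<open>t\<^sup>2\<close> may depend on \<open>t\<close> in any way as long as it stays bounded; that is the
  form in which Taylor's formula delivers it.
\<close>

lemma der_norm2_has_derivative:
  assumes \<phi>: "coordinate \<phi>" and u: "u \<in> smooth U V" and x: "x \<in> smooth U V"
    and y: "\<And>t::real. \<bar>t\<bar> \<le> 1 \<Longrightarrow> y t \<in> smooth U V \<and> wnorm 1 (y t) \<le> C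
        \<and> v t = u + complex_of_real t *\<^sub>C x + complex_of_real (t\<^sup>2) *\<^sub>C y t"
  shows "((\<lambda>t. (norm2 (der \<phi> (v t)))\<^sup>2) has_real_derivative
      2 * Re (\<tau> (star (der \<phi> u) * der \<phi> x))) (at 0)"
proof (rule has_derivative_of_quadratic_bound)
  fix t :: real assume t: "\<bar>t\<bar> \<le> 1"
  define a where "a = der \<phi> u"
  define b where "b = der \<phi> x"
  define c where "c = der \<phi> (y t)"
  have dv: "der \<phi> (v t) = (a + complex_of_real t *\<^sub>C b) + complex_of_real (t\<^sup>2) *\<^sub>C c"
    using y[OF t] by (simp add: a_def b_def c_def der_add[OF \<phi>] der_scaleC[OF \<phi>] u x
        smooth_add smooth_scaleC del: of_real_power)
  have "v 0 = u" using y[of 0] by simp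
  then have dv0: "der \<phi> (v 0) = a" by (simp add: a_def)
  have C: "norm2 c \<le> C"
  proof -
    have "norm2 c \<le> wnorm 0 c" unfolding c_def using y[OF t] by (intro norm2_le_wnorm der_smooth \<phi>) auto
    also have "\<dots> \<le> wnorm 1 (y t)" unfolding c_def using y[OF t] der_smooth(3)[OF \<phi>, of "y t" 0] by simp
    finally show ?thesis using y[OF t] by simp
  qed
  have C0: "0 \<le> C" using C norm2_nonneg order_trans by blast
  have ab: "norm2 (a + complex_of_real t *\<^sub>C b) \<le> norm2 a + norm2 b"
    using norm2_triangle[of a "complex_of_real t *\<^sub>C b"] t mult_right_mono[of "\<bar>t\<bar>" 1 "norm2 b"]
    by (simp add: norm2_scaleC)
  define r where "r = Re (\<tau> (star (a + complex_of_real t *\<^sub>C b) * c))"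
  have r: "\<bar>r\<bar> \<le> (norm2 a + norm2 b) * C"
  proof -
    have "\<bar>r\<bar> \<le> norm2 (a + complex_of_real t *\<^sub>C b) * norm2 c"
      unfolding r_def using abs_Re_le_cmod trace_Cauchy_Schwarz order_trans by blast
    also have "\<dots> \<le> (norm2 a + norm2 b) * C"
      using ab C by (intro mult_mono) auto
    finally show ?thesis .
  qed
  have N1: "(norm2 (a + complex_of_real t *\<^sub>C b))\<^sup>2
      = (norm2 a)\<^sup>2 + 2 * t * Re (\<tau> (star a * b)) + t\<^sup>2 * (norm2 b)\<^sup>2"
    by (simp add: norm2_add_square mult_scaleC_right trace_scaleC norm2_scaleC power_mult_distrib)
  have N2: "(norm2 (der \<phi> (v t)))\<^sup>2
      = (norm2 (a + complex_of_real t *\<^sub>C b))\<^sup>2 + 2 * (t\<^sup>2 * r) + (t\<^sup>2 * norm2 c)\<^sup>2"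
    unfolding dv norm2_add_square[of "a + complex_of_real t *\<^sub>C b"]
    by (simp add: mult_scaleC_right trace_scaleC norm2_scaleC r_def norm_power del: of_real_power)
  have N: "(norm2 (der \<phi> (v t)))\<^sup>2 - (norm2 (der \<phi> (v 0)))\<^sup>2 - 2 * Re (\<tau> (star a * b)) * t
      = t\<^sup>2 * ((norm2 b)\<^sup>2 + 2 * r + (t * norm2 c)\<^sup>2)"
    unfolding N2 N1 dv0 by (simp add: algebra_simps power2_eq_square)
  have "\<bar>(norm2 b)\<^sup>2 + 2 * r + (t * norm2 c)\<^sup>2\<bar> \<le> (norm2 b)\<^sup>2 + 2 * ((norm2 a + norm2 b) * C) + C\<^sup>2"
  proof -
    have "\<bar>t * norm2 c\<bar> \<le> C"
      using mult_mono[OF t C] C0 by (simp add: abs_mult)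
    then have "(t * norm2 c)\<^sup>2 \<le> C\<^sup>2" by (rule power2_le_iff_abs_le[THEN iffD2, OF C0])
    then show ?thesis using r by (smt (verit) zero_le_power2)
  qed
  then show "\<bar>(norm2 (der \<phi> (v t)))\<^sup>2 - (norm2 (der \<phi> (v 0)))\<^sup>2 - 2 * Re (\<tau> (star (der \<phi> u) * der \<phi> x)) * t\<bar>
      \<le> ((norm2 b)\<^sup>2 + 2 * ((norm2 a + norm2 b) * C) + C\<^sup>2) * t\<^sup>2"
    unfolding a_def[symmetric] b_def[symmetric] N abs_mult
    by (simp add: mult.commute[of "t\<^sup>2"] mult_right_mono)
qed

text \<open>
  Taylor's formula for \<open>exp (ith)\<close> gives \<open>u exp (ith) = u + t (i u h) + t\<^sup>2 y t\<close> with
  \<open>y t = - u h\<^sup>2 z t\<close>, where \<open>z t\<close> is bounded for \<open>\<bar>t\<bar> \<le> 1\<close> in every weighted norm.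
\<close>

lemma first_variation:
  assumes u: "u \<in> smooth U V" and h: "h \<in> smooth U V"
  shows "((\<lambda>t::real. energy U V \<tau> (u * exp ((\<i> * t) *\<^sub>C h))) has_real_derivative
      4 * pi\<^sup>2 * (Re (\<tau> (star (der fst u) * der fst (\<i> *\<^sub>C (u * h))))
        + Re (\<tau> (star (der snd u) * der snd (\<i> *\<^sub>C (u * h)))))) (at 0)"
proof -
  define C where "C = wnorm 1 u * wnorm 1 h * wnorm 1 h * exp (wnorm 1 h)"
  define v where "v t = u * exp ((\<i> * complex_of_real t) *\<^sub>C h)" for t
  have ex: "\<exists>y. (\<bar>t\<bar> \<le> 1 \<longrightarrow> y \<in> smooth U V \<and> wnorm 1 y \<le> C) \<and> v t \<in> smooth U V
        \<and> v t = u + complex_of_real t *\<^sub>C (\<i> *\<^sub>C (u * h)) + complex_of_real (t\<^sup>2) *\<^sub>C y" for t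
  proof -
    define x where "x = (\<i> * complex_of_real t) *\<^sub>C h"
    have x: "x \<in> smooth U V" "wnorm k x = \<bar>t\<bar> * wnorm k h" for k
      by (simp_all add: x_def smooth_scaleC h norm_mult)
    obtain z where z: "z \<in> smooth U V" "\<And>k. wnorm k z \<le> exp (wnorm k x)" "exp x = 1 + x + x * x * z"
      using smooth_exp_Taylor[OF x(1)] by blast
    define y where "y = - (u * h * h * z)"
    have ys: "y \<in> smooth U V" by (simp add: y_def smooth_minus smooth_mult u h z)
    have "wnorm 1 y \<le> C" if "\<bar>t\<bar> \<le> 1"
    proof -
      have "wnorm 1 z \<le> exp (wnorm 1 h)"
        using z(2)[of 1] mult_right_mono[OF that wnorm_nonneg[of 1 h]] x(2)[of 1]
        by (smt (verit) exp_le_cancel_iff)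
      moreover have "wnorm 1 (u * h) \<le> wnorm 1 u * wnorm 1 h" by (rule smooth_mult[OF u h])
      moreover have "wnorm 1 (u * h * h) \<le> wnorm 1 (u * h) * wnorm 1 h"
        by (intro smooth_mult u h)
      moreover have "wnorm 1 y \<le> wnorm 1 (u * h * h) * wnorm 1 z"
        unfolding y_def by (subst smooth_minus) (intro smooth_mult u h z)+
      ultimately show ?thesis unfolding C_def
        by (meson mult_mono mult_right_mono order_trans wnorm_nonneg mult_nonneg_nonneg)
    qed
    moreover have v: "v t = u + complex_of_real t *\<^sub>C (\<i> *\<^sub>C (u * h)) + complex_of_real (t\<^sup>2) *\<^sub>C y"
    proof -
      have "u * x = complex_of_real t *\<^sub>C (\<i> *\<^sub>C (u * h))"
        by (simp add: x_def mult_scaleC_right scaleC_scaleC mult.commute[of \<i>])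
      moreover have "u * (x * x * z)
          = ((\<i> * complex_of_real t) * (\<i> * complex_of_real t)) *\<^sub>C (u * h * h * z)"
        by (simp only: x_def mult_scaleC_left mult_scaleC_right scaleC_scaleC mult.assoc)
      moreover have "(\<i> * complex_of_real t) * (\<i> * complex_of_real t) = - complex_of_real (t\<^sup>2)"
        by (simp add: power2_eq_square algebra_simps)
      ultimately show ?thesis
        unfolding v_def x_def[symmetric] z(3) y_def
        by (simp add: distrib_left scaleC_minus_left scaleC_minus_right)
    qed
    moreover have "v t \<in> smooth U V"
      unfolding v by (intro smooth_add smooth_scaleC smooth_mult u h ys)
    ultimately show ?thesis using ys by blast
  qed
  then obtain y where y: "\<And>t. (\<bar>t\<bar> \<le> 1 \<longrightarrow> y t \<in> smooth U V \<and> wnorm 1 (y t) \<le> C) \<and> v t \<in> smooth U V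
        \<and> v t = u + complex_of_real t *\<^sub>C (\<i> *\<^sub>C (u * h)) + complex_of_real (t\<^sup>2) *\<^sub>C y t"
    by metis
  have d: "((\<lambda>t. (norm2 (der \<phi> (v t)))\<^sup>2) has_real_derivative
      2 * Re (\<tau> (star (der \<phi> u) * der \<phi> (\<i> *\<^sub>C (u * h))))) (at 0)" if "coordinate \<phi>" for \<phi>
    using y by (intro der_norm2_has_derivative[where C = C and y = y] that u smooth_scaleC smooth_mult h) blast
  have "((\<lambda>t. 2 * pi\<^sup>2 * ((norm2 (der fst (v t)))\<^sup>2 + (norm2 (der snd (v t)))\<^sup>2)) has_real_derivative
      2 * pi\<^sup>2 * (2 * Re (\<tau> (star (der fst u) * der fst (\<i> *\<^sub>C (u * h))))
        + 2 * Re (\<tau> (star (der snd u) * der snd (\<i> *\<^sub>C (u * h)))))) (at 0)"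
    by (intro DERIV_cmult DERIV_add d coordinate_simps)
  moreover have "energy U V \<tau> (u * exp ((\<i> * t) *\<^sub>C h))
      = 2 * pi\<^sup>2 * ((norm2 (der fst (v t)))\<^sup>2 + (norm2 (der snd (v t)))\<^sup>2)" for t :: real
    using energy_eq[of "v t"] y[of t] unfolding v_def by blast
  ultimately show ?thesis by (simp add: algebra_simps)
qed

lemma harmonic_iff:
  "harmonic U V \<tau> u \<longleftrightarrow> u \<in> smooth U V \<and> unitary u \<and>
     (\<forall>h \<in> smooth U V. star h = h \<longrightarrow>
        Re (\<tau> (star (der fst u) * der fst (\<i> *\<^sub>C (u * h))))
        + Re (\<tau> (star (der snd u) * der snd (\<i> *\<^sub>C (u * h)))) = 0)"
proof -
  have "((\<lambda>t::real. energy U V \<tau> (u * exp ((\<i> * t) *\<^sub>C h))) has_real_derivative 0) (at 0) \<longleftrightarrow>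
      Re (\<tau> (star (der fst u) * der fst (\<i> *\<^sub>C (u * h))))
        + Re (\<tau> (star (der snd u) * der snd (\<i> *\<^sub>C (u * h)))) = 0"
    if "u \<in> smooth U V" "h \<in> smooth U V" for h
  proof -
    let ?S = "Re (\<tau> (star (der fst u) * der fst (\<i> *\<^sub>C (u * h))))
        + Re (\<tau> (star (der snd u) * der snd (\<i> *\<^sub>C (u * h))))"
    have "((\<lambda>t::real. energy U V \<tau> (u * exp ((\<i> * t) *\<^sub>C h))) has_real_derivative 0) (at 0)
        \<longleftrightarrow> 4 * pi\<^sup>2 * ?S = 0"
      using first_variation[OF that] DERIV_unique by metis
    also have "\<dots> \<longleftrightarrow> ?S = 0" by (subst mult_eq_0_iff) simp
    finally show ?thesis .
  qed
  then show ?thesis unfolding harmonic_def smooth_unitaries_def by auto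
qed

section \<open>Monomials are harmonic\<close>

lemma der_monomial: "coordinate \<phi> \<Longrightarrow> der \<phi> (z *\<^sub>C W s) = of_int (\<phi> s) *\<^sub>C (z *\<^sub>C W s)"
  by (simp add: der_scaleC der_W smooth_W scaleC_scaleC mult.commute)

lemma monomial_smooth_unitary:
  assumes "cmod z = 1" shows "z *\<^sub>C W s \<in> smooth U V" "unitary (z *\<^sub>C W s)"
  by (simp_all add: smooth_scaleC smooth_W unitary_scaleC unitary_W assms)

text \<open>
  Pairing with the eigenvector \<open>u\<close> of \<open>der \<phi>\<close> picks out one Fourier coefficient, so that both
  derivatives become the factor \<open>\<phi> s\<close> and \<open>i \<tau> h\<close> remains.
\<close>

lemma harmonic_monomial: assumes z: "cmod z = 1" shows "harmonic U V \<tau> (z *\<^sub>C W s)"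
proof -
  define u where "u = z *\<^sub>C W s"
  have u: "u \<in> smooth U V" "unitary u" using monomial_smooth_unitary[OF z] by (simp_all add: u_def)
  have "Re (\<tau> (star (der \<phi> u) * der \<phi> (\<i> *\<^sub>C (u * h)))) = 0"
    if \<phi>: "coordinate \<phi>" and h: "h \<in> smooth U V" "star h = h" for \<phi> h
  proof -
    let ?x = "\<i> *\<^sub>C (u * h)"
    have x: "?x \<in> smooth U V" by (intro smooth_scaleC smooth_mult u h)
    have "\<tau> (star (der \<phi> u) * der \<phi> ?x) = of_int (\<phi> s) * (cnj z * coef (der \<phi> ?x) s)"
      by (simp add: u_def der_monomial[OF \<phi>] star_scaleC mult_scaleC_left trace_scaleC coef_def)
    also have "\<dots> = (of_int (\<phi> s))\<^sup>2 * (cnj z * coef ?x s)"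
      by (simp add: der_smooth[OF \<phi> x] power2_eq_square)
    also have "cnj z * coef ?x s = \<tau> (star u * ?x)"
      by (simp add: u_def star_scaleC mult_scaleC_left trace_scaleC coef_def)
    also have "\<dots> = \<i> * \<tau> h"
      by (simp add: mult_scaleC_right trace_scaleC unitary_cancel u)
    finally have "\<tau> (star (der \<phi> u) * der \<phi> ?x) = complex_of_real ((of_int (\<phi> s))\<^sup>2) * (\<i> * \<tau> h)"
      by simp
    moreover have "Im (\<tau> h) = 0" using trace_star[of h] h(2) by (simp add: complex_eq_iff)
    ultimately show ?thesis by (simp del: of_real_power)
  qed
  then show ?thesis unfolding harmonic_iff u_def[symmetric] using u by simp
qed

section \<open>Harmonic unitaries depending on one generator\<close>

text \<open>
  The test direction is \<open>h = i D f\<close> for the logarithmic derivative \<open>f = u\<^sup>* D u\<close>. Since \<open>der \<psi>\<close> kills \<open>u\<close>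
  it also kills \<open>f\<close>, so that \<open>D f = 0\<close> makes \<open>f\<close> a scalar.
\<close>

lemma harmonic_der_eigenvector:
  fixes \<phi> \<psi> :: "int \<times> int \<Rightarrow> int"
  assumes \<phi>\<psi>: "\<phi> = fst \<and> \<psi> = snd \<or> \<phi> = snd \<and> \<psi> = fst"
    and harm: "harmonic U V \<tau> u" and \<psi>u: "der \<psi> u = 0"
  obtains \<kappa> where "der \<phi> u = \<kappa> *\<^sub>C u"
proof -
  have \<phi>: "coordinate \<phi>" and \<psi>: "coordinate \<psi>" using \<phi>\<psi> by auto
  have u: "u \<in> smooth U V" and un: "unitary u"
    using harm by (simp_all add: harmonic_iff)
  define D where "D = der \<phi>"
  note D_rules = der_scaleC[OF \<phi>, folded D_def] der_mult[OF \<phi>, folded D_def]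
    der_star[OF \<phi>, folded D_def] trace_der[OF \<phi>, folded D_def] der_smooth(1)[OF \<phi>, folded D_def]
  define f where "f = star u * D u"
  have f: "f \<in> smooth U V" by (simp add: f_def smooth_mult smooth_star D_rules u)
  have Df: "D f \<in> smooth U V" "D (D f) \<in> smooth U V" by (simp_all add: D_rules f)
  have "D (star u * u) = 0" using un by (simp add: unitary_def D_def der_one[OF \<phi>])
  then have f': "star (D u) * u = f"
    by (simp add: D_rules u smooth_star f_def)
  then have star_f: "star f = f" by (metis f_def star_mult star_star)
  have star_Df: "star (D f) = - D f" using D_rules(3)[OF f] unfolding star_f by (metis minus_minus)
  define h where "h = \<i> *\<^sub>C D f"
  have h: "h \<in> smooth U V" "star h = h"
    by (simp_all add: h_def smooth_scaleC Df star_scaleC star_Df scaleC_minus_left scaleC_minus_right)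
  have "Re (\<tau> (star (der \<phi> u) * der \<phi> (\<i> *\<^sub>C (u * h)))) = 0"
    using harm h \<phi>\<psi> \<psi>u by (auto simp: harmonic_iff trace_zero)
  moreover have "\<tau> (star (D u) * D (\<i> *\<^sub>C (u * h)))
      = \<i> * \<tau> (star (D u) * D u * h) + \<i> * \<tau> (f * D h)"
    by (simp add: D_rules smooth_mult u h mult_scaleC_right trace_scaleC distrib_left trace_add
        f'[symmetric] mult.assoc)
  moreover have "Im (\<tau> (star (D u) * D u * h)) = 0"
  proof -
    have "\<tau> (star (D u) * D u * h) = \<tau> (h * (star (D u) * D u))" by (rule trace_commute)
    also have "\<dots> = cnj (\<tau> (star (D u) * D u * h))"
      unfolding trace_star[symmetric] by (simp add: star_mult star_star h(2) mult.assoc)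
    finally show ?thesis by (simp add: complex_eq_iff)
  qed
  moreover have "\<i> * \<tau> (f * D h) = - complex_of_real ((norm2 (D f))\<^sup>2)"
  proof -
    have "\<tau> (D (f * D f)) = 0" by (intro D_rules(4) smooth_mult f Df)
    then have "\<tau> (D f * D f) = - \<tau> (f * D (D f))"
      by (simp add: D_rules f Df trace_add eq_neg_iff_add_eq_0)
    moreover have "\<i> * \<tau> (f * D h) = - \<tau> (f * D (D f))"
      by (simp add: h_def D_rules Df mult_scaleC_right trace_scaleC mult.assoc[symmetric])
    ultimately have "\<i> * \<tau> (f * D h) = \<tau> (D f * D f)" by simp
    then show ?thesis
      by (simp add: norm2_square_complex star_Df trace_minus del: of_real_power)
  qed
  ultimately have "norm2 (D f) = 0" unfolding D_def[symmetric] by (simp del: of_real_power)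
  then have \<phi>f: "der \<phi> f = 0" using norm2_eq_0_iff[OF Df(1)] by (simp add: D_def)
  have "der \<psi> (D u) = 0"
    using der_commute[OF \<psi> \<phi> u] \<psi>u by (simp add: D_def der_def coef_def trace_zero)
  then have \<psi>f: "der \<psi> f = 0"
    by (simp add: f_def der_mult[OF \<psi>] der_star[OF \<psi>] smooth_star u D_rules \<psi>u)
  have "f = \<tau> f *\<^sub>C 1"
  proof (rule smooth_eqI)
    fix p :: "int \<times> int"
    have "of_int (\<phi> p) * coef f p = 0" "of_int (\<psi> p) * coef f p = 0"
      using der_smooth(2)[OF \<phi> f, of p] der_smooth(2)[OF \<psi> f, of p]
      by (simp_all only: \<phi>f \<psi>f) (simp_all add: coef_def trace_zero)
    moreover have "\<phi> p \<noteq> 0 \<or> \<psi> p \<noteq> 0" if "p \<noteq> 0"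
      using \<phi>\<psi> that by (auto simp: prod_eq_iff)
    ultimately show "coef f p = coef (\<tau> f *\<^sub>C 1) p"
      by (cases "p = 0") (auto simp: coef_scaleC coef_one coef_0 trace_scaleC trace_one)
  qed (simp_all add: f smooth_scaleC smooth_one)
  then have "u * f = \<tau> f *\<^sub>C u" by (metis mult_scaleC_right mult_1_right)
  then have "der \<phi> u = \<tau> f *\<^sub>C u" by (simp add: f_def unitary_cancel un D_def)
  then show ?thesis by (rule that)
qed

text \<open>
  The eigenvalue equation fixes the coordinate \<open>\<phi> p\<close>, the hypothesis fixes \<open>\<psi> p\<close>, and so only one
  coefficient can be nonzero.
\<close>

lemma harmonic_one_generator:
  fixes \<phi> \<psi> :: "int \<times> int \<Rightarrow> int"
  assumes \<phi>\<psi>: "\<phi> = fst \<and> \<psi> = snd \<or> \<phi> = snd \<and> \<psi> = fst"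
    and harm: "harmonic U V \<tau> u" and dep: "\<And>p. \<psi> p \<noteq> 0 \<Longrightarrow> coef u p = 0"
  obtains p where "\<psi> p = 0" "unit_scalar_multiple u (W p)"
proof -
  have \<phi>: "coordinate \<phi>" and \<psi>: "coordinate \<psi>" using \<phi>\<psi> by auto
  have u: "u \<in> smooth U V" and un: "unitary u"
    using harm by (simp_all add: harmonic_iff)
  have "of_int (\<psi> p) * coef u p = 0" for p using dep[of p] by auto
  then have "der \<psi> u = 0" by (simp only: der_def scaleC_zero_left infsum_0_simp)
  then obtain \<kappa> where \<kappa>: "der \<phi> u = \<kappa> *\<^sub>C u"
    using harmonic_der_eigenvector[OF \<phi>\<psi> harm] by blast
  have eigen: "of_int (\<phi> p) * coef u p = \<kappa> * coef u p" for p
    using der_smooth(2)[OF \<phi> u, of p] by (simp only: \<kappa> coef_scaleC)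
  have "\<exists>p. coef u p \<noteq> 0"
  proof (rule ccontr)
    assume "\<nexists>p. coef u p \<noteq> 0"
    then have "u = 0"
      using coef_scaleC[of 0 u] smooth_scaleC(1)[OF u, of 0] by (intro smooth_eqI u) auto
    then show False using un by (simp add: unitary_def)
  qed
  then obtain p where p: "coef u p \<noteq> 0" by blast
  have only: "coef u q = 0" if "q \<noteq> p" for q
  proof (rule ccontr)
    assume q: "coef u q \<noteq> 0"
    have "of_int (\<phi> q) = \<kappa>" "of_int (\<phi> p) = \<kappa>" using eigen[of q] eigen[of p] p q by auto
    then have "\<phi> q = \<phi> p" by (metis of_int_eq_iff)
    moreover have "\<psi> q = \<psi> p" using dep p q by metis
    ultimately have "q = p" using \<phi>\<psi> by (auto simp: prod_eq_iff)
    with that show False by simp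
  qed
  have "((\<lambda>q. coef u q *\<^sub>C W q) has_sum coef u p *\<^sub>C W p) UNIV"
    by (rule has_sum_finite_neutralI[of "{p}"]) (auto simp: only)
  then have eq: "u = coef u p *\<^sub>C W p" using has_sum_unique[OF smooth_has_sum[OF u]] by blast
  have "cmod (coef u p) = 1"
    using norm2_unitary[OF un] norm2_scaleC[of "coef u p" "W p"]
    by (simp add: eq[symmetric] norm2_unitary unitary_W)
  with eq have "unit_scalar_multiple u (W p)" unfolding unit_scalar_multiple_def by blast
  then show ?thesis using dep[of p] p that by blast
qed

section \<open>Monomials are strict local minima\<close>

text \<open>
  The cross term is \<open>2 \<phi> s Re \<tau> (a\<^sup>* D a)\<close>. Both \<open>\<tau> (a D a)\<close> and \<open>\<tau> (D a)\<close> are traces of derivatives up to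
  a factor and vanish; this allows replacing \<open>a\<^sup>*\<close> by \<open>b\<close> and \<open>D a\<close> by the derivative of \<open>d\<close>.
\<close>

lemma coordinate_energy_gap:
  assumes \<phi>: "coordinate \<phi>" and a: "a \<in> smooth U V" "unitary a" and z: "cmod z = 1"
  defines "b \<equiv> a + star a - 2" and "d \<equiv> a - star a"
  shows "(norm2 (der \<phi> d))\<^sup>2 / 4 - \<bar>real_of_int (\<phi> s)\<bar> * norm2 b * norm2 (der \<phi> d)
     \<le> (norm2 (der \<phi> (z *\<^sub>C W s * a)))\<^sup>2 - (norm2 (der \<phi> (z *\<^sub>C W s)))\<^sup>2"
proof -
  define u where "u = z *\<^sub>C W s"
  have u: "u \<in> smooth U V" "unitary u" using monomial_smooth_unitary[OF z] by (simp_all add: u_def)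
  define D where "D = der \<phi> a"
  have D: "D \<in> smooth U V" by (simp add: D_def der_smooth \<phi> a)
  have star_D: "der \<phi> (star a) = - star D" by (simp add: D_def der_star \<phi> a)
  have dd: "der \<phi> d = D + star D"
    by (simp add: d_def der_diff[OF \<phi>] smooth_star a star_D D_def[symmetric])
  have du: "der \<phi> u = of_int (\<phi> s) *\<^sub>C u" by (simp add: u_def der_monomial[OF \<phi>])
  have "der \<phi> (u * a) = u * (of_int (\<phi> s) *\<^sub>C a + D)"
    by (simp add: der_mult[OF \<phi>] u a du D_def mult_scaleC_left mult_scaleC_right distrib_left)
  then have N: "(norm2 (der \<phi> (u * a)))\<^sup>2
      = (real_of_int (\<phi> s))\<^sup>2 + 2 * (of_int (\<phi> s) * Re (\<tau> (star a * D))) + (norm2 D)\<^sup>2"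
    by (simp add: norm2_unitary_mult u norm2_add_square norm2_scaleC norm2_unitary a star_scaleC
        mult_scaleC_left trace_scaleC)
  have N0: "(norm2 (der \<phi> u))\<^sup>2 = (real_of_int (\<phi> s))\<^sup>2"
    by (simp add: du norm2_scaleC norm2_unitary u)
  have cross: "\<bar>2 * Re (\<tau> (star a * D))\<bar> \<le> norm2 b * norm2 (der \<phi> d)"
  proof -
    have "\<tau> (der \<phi> (a * a)) = 0" by (rule trace_der[OF \<phi>]) (simp add: smooth_mult a)
    then have aD: "\<tau> (a * D) = 0"
      by (simp add: der_mult[OF \<phi>] a D_def[symmetric] trace_add trace_commute[of D a])
    then have "\<tau> (star a * star D) = 0"
      using trace_star[of "D * a"] by (simp add: star_mult trace_commute[of D a])
    moreover have "\<tau> (a * star D) = cnj (\<tau> (star a * D))"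
      using trace_star[of "D * star a"] by (simp add: star_mult star_star trace_commute[of D "star a"])
    moreover have "\<tau> D = 0" by (simp add: D_def trace_der \<phi> a)
    moreover have "\<tau> (star D) = 0" using \<open>\<tau> D = 0\<close> by (simp add: trace_star)
    ultimately have "\<tau> (b * der \<phi> d) = \<tau> (star a * D) + cnj (\<tau> (star a * D))"
      unfolding b_def dd numeral_2_eq_2
      using aD by (simp add: algebra_simps trace_add trace_diff mult_2)
    then have "Re (\<tau> (b * der \<phi> d)) = 2 * Re (\<tau> (star a * D))" by simp
    moreover have "star b = b"
      using star_add[of "1::'a" 1] by (simp add: b_def star_diff star_add star_star add.commute)
    ultimately show ?thesis
      using trace_Cauchy_Schwarz[of b "der \<phi> d"] abs_Re_le_cmod[of "\<tau> (b * der \<phi> d)"] by simp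
  qed
  have "norm2 (der \<phi> d) \<le> 2 * norm2 D"
    using norm2_triangle[of D "star D"] by (simp add: dd)
  then have "(norm2 (der \<phi> d))\<^sup>2 \<le> (2 * norm2 D)\<^sup>2" by (intro power_mono) auto
  moreover have "\<bar>of_int (\<phi> s) * (2 * Re (\<tau> (star a * D)))\<bar>
      \<le> \<bar>real_of_int (\<phi> s)\<bar> * (norm2 b * norm2 (der \<phi> d))"
    unfolding abs_mult[of "of_int (\<phi> s)"] by (rule mult_left_mono[OF cross]) simp
  ultimately show ?thesis
    unfolding u_def[symmetric] N N0 by (simp add: power_mult_distrib mult.assoc abs_le_iff)
qed

text \<open>
  For a unitary \<open>a\<close> near \<open>1\<close> the real part differs from \<open>1\<close> only by second order in the imaginary part:
  \<open>a\<^sup>* a = a a\<^sup>* = 1\<close> gives \<open>4 b = d\<^sup>2 - b\<^sup>2\<close>, and the small term \<open>b\<^sup>2\<close> is absorbed on the left.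
\<close>

lemma real_part_deviation_le:
  assumes a: "a \<in> smooth U V" "unitary a" and \<eta>: "wnorm 0 (a - 1) \<le> \<eta>" "\<eta> \<le> 1 / 2"
  shows "norm2 (a + star a - 2) \<le> \<eta> * norm2 (a - star a)"
proof -
  define b where "b = a + star a - 2"
  define d where "d = a - star a"
  define e where "e = a - 1"
  have e: "e \<in> smooth U V" by (simp add: e_def smooth_diff a smooth_one)
  have b_e: "b = e + star e" by (simp add: b_def e_def star_diff)
  have d_e: "d = e - star e" by (simp add: d_def e_def star_diff)
  have bs: "b \<in> smooth U V" "wnorm 0 b \<le> 2 * \<eta>"
    using smooth_add(2)[OF e smooth_star(1)[OF e], of 0] \<eta>(1)
    by (simp_all add: b_e smooth_add smooth_star e e_def[symmetric])
  have ds: "d \<in> smooth U V" "wnorm 0 d \<le> 2 * \<eta>"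
    using smooth_diff(2)[OF e smooth_star(1)[OF e], of 0] \<eta>(1)
    by (simp_all add: d_e smooth_diff smooth_star e e_def[symmetric])
  have aa: "a * star a = 1" "star a * a = 1" using a(2) by (simp_all add: unitary_def)
  have "(4::complex) *\<^sub>C b = d * d - b * b"
  proof -
    have "e * star e + (e + star e) = 0" "star e * e + (e + star e) = 0"
      by (simp_all add: e_def star_diff algebra_simps aa)
    then have "e * star e = - (e + star e)" "star e * e = - (e + star e)"
      by (simp_all only: eq_neg_iff_add_eq_0)
    moreover have "d * d - b * b = - (e * star e) - e * star e - star e * e - star e * e"
      unfolding b_e d_e by (simp add: algebra_simps)
    ultimately have "d * d - b * b = b + b + b + b"
      unfolding b_e by simp
    also have "\<dots> = (1 + 1 + 1 + 1) *\<^sub>C b" by (simp only: scaleC_add_left scaleC_one)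
    finally show ?thesis by simp
  qed
  then have "4 * norm2 b = norm2 (d * d - b * b)" using norm2_scaleC[of 4 b] by simp
  also have "\<dots> \<le> norm2 (d * d) + norm2 (b * b)" by (rule norm2_triangle_diff)
  also have "\<dots> \<le> 2 * \<eta> * norm2 d + 1 * norm2 b"
  proof (rule add_mono)
    show "norm2 (d * d) \<le> 2 * \<eta> * norm2 d"
      using norm2_mult_le[OF ds(1), of d] mult_right_mono[OF ds(2), of "norm2 d"] by simp
    show "norm2 (b * b) \<le> 1 * norm2 b"
      using norm2_mult_le[OF bs(1), of b] mult_right_mono[of "wnorm 0 b" 1 "norm2 b"] bs(2) \<eta>(2) by simp
  qed
  finally have "3 * norm2 b \<le> 2 * (\<eta> * norm2 d)" by simp
  moreover have "0 \<le> \<eta>" using \<eta>(1) wnorm_nonneg[of 0 "a - 1"] by linarith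
  then have "0 \<le> \<eta> * norm2 d" by simp
  ultimately show ?thesis unfolding b_def d_def by linarith
qed

text \<open>
  A nonzero lattice point has squared length at least \<open>1\<close>.
\<close>

lemma Poincare:
  assumes d: "d \<in> smooth U V" and d0: "\<tau> d = 0"
  shows "(norm2 d)\<^sup>2 \<le> (norm2 (der fst d))\<^sup>2 + (norm2 (der snd d))\<^sup>2"
proof (rule has_sum_mono[OF Parseval[OF d]])
  show "((\<lambda>p. (cmod (coef (der fst d) p))\<^sup>2 + (cmod (coef (der snd d) p))\<^sup>2)
      has_sum (norm2 (der fst d))\<^sup>2 + (norm2 (der snd d))\<^sup>2) UNIV"
    by (intro has_sum_add Parseval der_smooth d coordinate_simps)
  fix p :: "int \<times> int"
  have "1 * (cmod (coef d p))\<^sup>2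
      \<le> ((real_of_int (fst p))\<^sup>2 + (real_of_int (snd p))\<^sup>2) * (cmod (coef d p))\<^sup>2" if "p \<noteq> 0"
  proof (rule mult_right_mono)
    have "0 < (fst p)\<^sup>2 + (snd p)\<^sup>2"
      using that by (simp add: sum_power2_gt_zero_iff prod_eq_iff)
    then have "1 \<le> (fst p)\<^sup>2 + (snd p)\<^sup>2" by simp
    then have "real_of_int 1 \<le> real_of_int ((fst p)\<^sup>2 + (snd p)\<^sup>2)" by (simp only: of_int_le_iff)
    then show "1 \<le> (real_of_int (fst p))\<^sup>2 + (real_of_int (snd p))\<^sup>2" by simp
  qed simp
  moreover have "coef d p = 0" if "p = 0" using d0 that by (simp add: coef_0)
  ultimately show "(cmod (coef d p))\<^sup>2 \<le> (cmod (coef (der fst d) p))\<^sup>2 + (cmod (coef (der snd d) p))\<^sup>2"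
    by (cases "p = 0") (simp_all add: der_smooth d norm_mult power_mult_distrib distrib_right)
qed

text \<open>
  With \<open>X\<close>, \<open>Y\<close> the norms of the derivatives of \<open>d\<close>, the positive part of the gap is at least
  \<open>(X\<^sup>2 + Y\<^sup>2) / 4\<close>, and the bound on \<open>\<eta>\<close> keeps the cross terms below half of that.
\<close>

lemma energy_gap:
  assumes a: "a \<in> smooth U V" "unitary a" and a0: "Im (\<tau> a) = 0"
    and \<eta>: "wnorm 0 (a - 1) \<le> \<eta>" "\<eta> * (\<bar>real_of_int (fst s)\<bar> + \<bar>real_of_int (snd s)\<bar> + 1) \<le> 1 / 16"
    and z: "cmod z = 1"
  shows "energy U V \<tau> (z *\<^sub>C W s) \<le> energy U V \<tau> (z *\<^sub>C W s * a)"
    and "energy U V \<tau> (z *\<^sub>C W s * a) = energy U V \<tau> (z *\<^sub>C W s) \<Longrightarrow> a = 1"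
proof -
  define u where "u = z *\<^sub>C W s"
  have u: "u \<in> smooth U V" "unitary u" using monomial_smooth_unitary[OF z] by (simp_all add: u_def)
  define b where "b = a + star a - 2"
  define d where "d = a - star a"
  define X where "X = norm2 (der fst d)"
  define Y where "Y = norm2 (der snd d)"
  define S where "S = \<bar>real_of_int (fst s)\<bar> + \<bar>real_of_int (snd s)\<bar>"
  define G where "G = ((norm2 (der fst (u * a)))\<^sup>2 + (norm2 (der snd (u * a)))\<^sup>2)
      - ((norm2 (der fst u))\<^sup>2 + (norm2 (der snd u))\<^sup>2)"
  have E: "energy U V \<tau> (u * a) - energy U V \<tau> u = 2 * pi\<^sup>2 * G"
    by (simp add: G_def energy_eq smooth_mult u a algebra_simps)
  have \<eta>0: "0 \<le> \<eta>" using \<eta>(1) wnorm_nonneg[of 0 "a - 1"] by linarith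
  have S: "0 \<le> S" "\<eta> * S + \<eta> \<le> 1 / 16" using \<eta>(2) by (simp_all add: S_def algebra_simps)
  have \<eta>S: "\<eta> * S \<le> 1 / 16" "\<eta> \<le> 1 / 2"
    using S \<eta>0 mult_nonneg_nonneg[OF \<eta>0 S(1)] by linarith+
  have d: "d \<in> smooth U V" by (simp add: d_def smooth_diff smooth_star a)
  have "\<tau> d = 0" using a0 by (simp add: d_def trace_diff trace_star complex_eq_iff)
  then have P: "(norm2 d)\<^sup>2 \<le> X\<^sup>2 + Y\<^sup>2" unfolding X_def Y_def by (rule Poincare[OF d])
  have XY: "0 \<le> X" "0 \<le> Y" by (simp_all add: X_def Y_def)
  have "(norm2 d)\<^sup>2 \<le> (X + Y)\<^sup>2" using P mult_nonneg_nonneg[OF XY] by (simp add: power2_sum)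
  then have dXY: "norm2 d \<le> X + Y" by (rule power2_le_imp_le) (simp add: XY)
  have b: "norm2 b \<le> \<eta> * norm2 d" unfolding b_def d_def by (rule real_part_deviation_le[OF a \<eta>(1) \<eta>S(2)])
  have bXY: "norm2 b \<le> \<eta> * (X + Y)" using b mult_left_mono[OF dXY \<eta>0] by simp
  have 1: "X\<^sup>2 / 4 - \<bar>real_of_int (fst s)\<bar> * norm2 b * X \<le> (norm2 (der fst (u * a)))\<^sup>2 - (norm2 (der fst u))\<^sup>2"
    using coordinate_energy_gap[OF coordinate_simps(1) a z, of s]
    unfolding X_def b_def d_def u_def .
  have 2: "Y\<^sup>2 / 4 - \<bar>real_of_int (snd s)\<bar> * norm2 b * Y \<le> (norm2 (der snd (u * a)))\<^sup>2 - (norm2 (der snd u))\<^sup>2"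
    using coordinate_energy_gap[OF coordinate_simps(2) a z, of s]
    unfolding Y_def b_def d_def u_def .
  have 3: "\<bar>real_of_int (\<phi> s)\<bar> * norm2 b * Z \<le> S * (\<eta> * (X + Y)) * Z" if "\<phi> = fst \<or> \<phi> = snd" "0 \<le> Z" for \<phi> Z
    using that XY \<eta>0 by (intro mult_right_mono mult_mono bXY) (auto simp: S_def)
  have "S * (\<eta> * (X + Y)) * X + S * (\<eta> * (X + Y)) * Y = \<eta> * S * (X + Y)\<^sup>2"
    by (simp add: algebra_simps power2_eq_square)
  also have "\<dots> \<le> 1 / 16 * (X + Y)\<^sup>2" by (rule mult_right_mono[OF \<eta>S(1)]) simp
  also have "\<dots> \<le> 1 / 8 * (X\<^sup>2 + Y\<^sup>2)"
    using zero_le_power2[of "X - Y"] by (simp add: power2_eq_square algebra_simps)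
  finally have "(X\<^sup>2 + Y\<^sup>2) / 8 \<le> G"
    using 1 2 3[of fst X] 3[of snd Y] XY unfolding G_def by simp
  then have G: "X\<^sup>2 + Y\<^sup>2 \<le> 8 * G" by simp
  then have G0: "0 \<le> G" using zero_le_power2[of X] zero_le_power2[of Y] by linarith
  have "0 \<le> 2 * pi\<^sup>2 * G" using G0 by simp
  then show "energy U V \<tau> (z *\<^sub>C W s) \<le> energy U V \<tau> (z *\<^sub>C W s * a)"
    using E unfolding u_def by linarith
  assume "energy U V \<tau> (z *\<^sub>C W s * a) = energy U V \<tau> (z *\<^sub>C W s)"
  then have "G = 0" using E by (simp add: u_def)
  then have "(norm2 d)\<^sup>2 \<le> 0" using P G by linarith
  then have nd: "norm2 d = 0" by simp
  then have nb: "norm2 b = 0" using b norm2_nonneg[of b] by simp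
  have "b \<in> smooth U V"
    using smooth_add(1)[OF smooth_one(1) smooth_one(1)] by (simp add: b_def smooth_diff smooth_add smooth_star a)
  then have "b = 0" "d = 0" using nb nd d norm2_eq_0_iff by auto
  then have "a + a = 1 + 1" by (simp add: b_def d_def)
  then have "2 *\<^sub>R a = 2 *\<^sub>R 1" unfolding scaleR_2 .
  then show "a = 1" using scaleR_left_imp_eq[of 2 a 1] by linarith
qed

text \<open>Smallness in the smooth topology implies smallness in the \<open>\<ell>\<^sup>1\<close>-norm used by \<open>energy_gap\<close>.\<close>

lemma wnorm_0_le_seminorm: assumes a: "a \<in> smooth U V"
  shows "wnorm 0 a \<le> smooth_seminorm U V 2 a * (\<Sum>\<^sub>\<infinity>(m, n). 1 / weight m n ^ 2)"
proof -
  have "rapidly_decreasing (fourier_coeff U V a)"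
  proof -
    have "fourier_coeff U V a = curry (coef a)" by (intro ext) (simp add: fourier_coeff_eq a)
    then show ?thesis using smooth_has_expansion[OF a] by (simp add: has_expansion_def)
  qed
  then have bdd: "bdd_above (range (\<lambda>(m, n). weight m n ^ 2 * cmod (fourier_coeff U V a m n)))"
    by (simp add: rapidly_decreasing_def)
  have "((\<lambda>p. smooth_seminorm U V 2 a * (case p of (m, n) \<Rightarrow> 1 / weight m n ^ 2))
      has_sum smooth_seminorm U V 2 a * (\<Sum>\<^sub>\<infinity>(m, n). 1 / weight m n ^ 2)) UNIV"
    by (rule has_sum_cmult_right[OF has_sum_infsum[OF summable_on_inverse_weight]])
  with wnorm_has_sum[OF a] show ?thesis
  proof (rule has_sum_mono)
    fix p :: "int \<times> int"
    obtain m n where p: "p = (m, n)" by force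
    have "weight m n ^ 2 * cmod (fourier_coeff U V a m n) \<le> smooth_seminorm U V 2 a"
      unfolding smooth_seminorm_def using cSUP_upper[OF UNIV_I bdd, of "(m, n)"] by simp
    then have "weight m n ^ 2 * cmod (coef a p) \<le> smooth_seminorm U V 2 a"
      by (simp add: fourier_coeff_eq a p)
    moreover have "0 < weight m n ^ 2" using weight_ge_1[of m n] by simp
    ultimately show "wt p ^ 0 * cmod (coef a p)
        \<le> smooth_seminorm U V 2 a * (case p of (m, n) \<Rightarrow> 1 / weight m n ^ 2)"
      by (simp add: p field_simps)
  qed
qed

text \<open>The phase \<open>l\<close> turns \<open>\<tau> e\<close> into its modulus; it is close to \<open>1\<close> because \<open>\<tau> e\<close> is.\<close>

lemma normalize_phase:
  assumes e: "e \<in> smooth U V"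
  obtains l where "cmod l = 1" "Im (\<tau> (l *\<^sub>C e)) = 0" "wnorm 0 (l *\<^sub>C e - 1) \<le> 3 * wnorm 0 (e - 1)"
proof -
  define c where "c = \<tau> e"
  define l where "l = (if c = 0 then 1 else cnj (sgn c))"
  have l: "cmod l = 1" by (simp add: l_def norm_sgn)
  have lc: "l * c = complex_of_real (cmod c)"
    by (simp add: l_def cnj_sgn_mult)
  have e1: "e - 1 \<in> smooth U V" by (simp add: smooth_diff e smooth_one)
  have c1: "cmod (c - 1) \<le> wnorm 0 (e - 1)"
    using cmod_coef_le_wnorm[OF e1, of 0] by (simp add: coef_0 trace_diff trace_one c_def)
  have "cmod (l - l * c) = cmod (c - 1)"
  proof -
    have "l - l * c = - l * (c - 1)" by (simp add: algebra_simps)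
    then show ?thesis by (simp only: norm_mult norm_minus_cancel l mult_1_left)
  qed
  moreover have "cmod (l * c - 1) \<le> cmod (c - 1)"
  proof -
    have "l * c - 1 = complex_of_real (cmod c - 1)" by (simp add: lc)
    then have "cmod (l * c - 1) = \<bar>cmod c - cmod 1\<bar>" by (simp only: norm_of_real norm_one)
    also have "\<dots> \<le> cmod (c - 1)" by (rule norm_triangle_ineq3)
    finally show ?thesis .
  qed
  ultimately have l1: "cmod (l - 1) \<le> 2 * cmod (c - 1)"
    using norm_triangle_ineq[of "l - l * c" "l * c - 1"] by simp
  have "l *\<^sub>C e - 1 = l *\<^sub>C (e - 1) + (l - 1) *\<^sub>C 1"
    by (simp add: scaleC_diff_right scaleC_diff_left)
  then have "wnorm 0 (l *\<^sub>C e - 1) \<le> wnorm 0 (l *\<^sub>C (e - 1)) + wnorm 0 ((l - 1) *\<^sub>C 1)"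
    by (simp only:) (intro smooth_add smooth_scaleC e1 smooth_one)
  also have "\<dots> = wnorm 0 (e - 1) + cmod (l - 1)"
    by (simp add: smooth_scaleC e1 smooth_one l)
  finally have "wnorm 0 (l *\<^sub>C e - 1) \<le> 3 * wnorm 0 (e - 1)" using l1 c1 by simp
  moreover have "Im (\<tau> (l *\<^sub>C e)) = 0" using lc by (simp add: trace_scaleC c_def)
  ultimately show ?thesis using l that by blast
qed

lemma strict_local_min_monomial:
  assumes z: "cmod z = 1" shows "strict_local_min_mod_scalars U V \<tau> (z *\<^sub>C W s)"
proof -
  define u where "u = z *\<^sub>C W s"
  have u: "u \<in> smooth U V" "unitary u" using monomial_smooth_unitary[OF z] by (simp_all add: u_def)
  define S where "S = \<bar>real_of_int (fst s)\<bar> + \<bar>real_of_int (snd s)\<bar> + 1"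
  \<comment> \<open>The summand \<open>1\<close> keeps \<open>K\<close> away from \<open>0\<close> without evaluating the series.\<close>
  define K where "K = (\<Sum>\<^sub>\<infinity>(m, n). 1 / weight m n ^ 2) + 1"
  have S: "1 \<le> S" by (simp add: S_def)
  have K: "1 \<le> K" unfolding K_def by (simp add: infsum_nonneg case_prod_unfold)
  \<comment> \<open>\<open>48 = 3 * 16\<close>: the factor \<open>3\<close> is lost in \<open>normalize_phase\<close>, and \<open>energy_gap\<close> asks for \<open>1 / 16\<close>.\<close>
  define \<epsilon> where "\<epsilon> = 1 / (48 * S * K)"
  have \<epsilon>: "0 < \<epsilon>" using S K by (simp add: \<epsilon>_def)
  define B where "B = {b \<in> smooth U V. smooth_seminorm U V 2 (b - u) < \<epsilon>}"
  define N where "N = B \<inter> smooth_unitaries U V"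
  have "openin (smooth_topology U V) B"
    unfolding smooth_topology_def B_def
    by (rule topology_generated_by_Basis) (use u \<epsilon> in blast)
  then have "openin (unitary_topology U V) N"
    unfolding unitary_topology_def N_def openin_subtopology by blast
  moreover have "u \<in> N"
  proof -
    have z0: "0 \<in> smooth U V" using smooth_diff(1)[OF u(1) u(1)] by simp
    have "fourier_coeff U V 0 = (\<lambda>m n. 0)"
      by (intro ext) (simp add: fourier_coeff_eq[OF z0] coef_def trace_zero)
    then have "smooth_seminorm U V 2 0 = 0" by (simp add: smooth_seminorm_def)
    then show ?thesis using u \<epsilon> by (simp add: N_def B_def smooth_unitaries_def)
  qed
  moreover have "energy U V \<tau> u \<le> energy U V \<tau> v \<and>
      (energy U V \<tau> v = energy U V \<tau> u \<longrightarrow> unit_scalar_multiple v u)" if "v \<in> N" for v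
  proof -
    have v: "v \<in> smooth U V" "unitary v" "smooth_seminorm U V 2 (v - u) < \<epsilon>"
      using that by (auto simp: N_def B_def smooth_unitaries_def)
    define e where "e = star u * v"
    have e: "e \<in> smooth U V" "unitary e"
      by (simp_all add: e_def smooth_mult smooth_star u v unitary_mult unitary_star)
    have vu: "v - u \<in> smooth U V" by (simp add: smooth_diff u v)
    have "e - 1 = star u * (v - u)" using u(2) by (simp add: e_def unitary_def right_diff_distrib)
    then have "wnorm 0 (e - 1) \<le> wnorm 0 (star u) * wnorm 0 (v - u)"
      using smooth_mult(2)[OF smooth_star(1)[OF u(1)] vu] by simp
    also have "\<dots> = wnorm 0 (v - u)"
      using u(1) by (simp add: smooth_star) (simp add: u_def smooth_scaleC smooth_W z)
    also have "\<dots> \<le> smooth_seminorm U V 2 (v - u) * (K - 1)"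
      using wnorm_0_le_seminorm[OF vu] by (simp add: K_def)
    also have "\<dots> \<le> \<epsilon> * K"
      using v(3) K \<epsilon> by (intro mult_mono) auto
    finally have "3 * wnorm 0 (e - 1) \<le> 1 / (16 * S)" using K S by (simp add: \<epsilon>_def field_simps)
    moreover obtain l where l: "cmod l = 1" "Im (\<tau> (l *\<^sub>C e)) = 0"
      "wnorm 0 (l *\<^sub>C e - 1) \<le> 3 * wnorm 0 (e - 1)"
      using normalize_phase[OF e(1)] by blast
    ultimately have w: "wnorm 0 (l *\<^sub>C e - 1) \<le> 1 / (16 * S)" by simp
    have ll: "cnj l * l = 1" using complex_norm_square[of l] l(1) by (simp add: mult.commute)
    have le: "l *\<^sub>C e \<in> smooth U V" "unitary (l *\<^sub>C e)"
      by (simp_all add: smooth_scaleC unitary_scaleC e l)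
    have "1 / (16 * S) * (\<bar>real_of_int (fst s)\<bar> + \<bar>real_of_int (snd s)\<bar> + 1) \<le> 1 / 16"
      unfolding S_def[symmetric] using S by simp
    note gap = energy_gap[OF le l(2) w this z]
    have ula: "u * (l *\<^sub>C e) = l *\<^sub>C v"
      by (simp add: mult_scaleC_right e_def unitary_cancel u)
    have "energy U V \<tau> (l *\<^sub>C v) = energy U V \<tau> v"
      by (simp add: energy_eq smooth_scaleC v der_scaleC norm2_scaleC l)
    then have E: "energy U V \<tau> (z *\<^sub>C W s * (l *\<^sub>C e)) = energy U V \<tau> v"
      using ula by (simp add: u_def)
    have "unit_scalar_multiple v u" if "l *\<^sub>C e = 1"
    proof -
      have "l *\<^sub>C v = u" using ula that by simp
      then have "v = cnj l *\<^sub>C u" by (metis ll scaleC_one scaleC_scaleC)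
      then show ?thesis using l(1) unfolding unit_scalar_multiple_def by (metis complex_mod_cnj)
    qed
    then show ?thesis using gap unfolding E u_def by blast
  qed
  ultimately show ?thesis unfolding strict_local_min_mod_scalars_def u_def[symmetric] by blast
qed

end

theorem theorem5p5:
  fixes \<theta> :: real and U V :: "'a::cstar_algebra" and \<tau> :: "'a \<Rightarrow> complex"
  assumes "irrational_rotation_algebra \<theta> U V"
    and "tracial_state \<tau>"
  shows "(\<forall>(m::int) (n::int) (z::complex). cmod z = 1 \<longrightarrow>
            harmonic U V \<tau> (z *\<^sub>C (upow U m * upow V n)) \<and>
            strict_local_min_mod_scalars U V \<tau> (z *\<^sub>C (upow U m * upow V n)))
       \<and> (\<forall>u. harmonic U V \<tau> u \<and> depends_on_U_alone U V u \<longrightarrow>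
            (\<exists>m::int. unit_scalar_multiple u (upow U m)))
       \<and> (\<forall>u. harmonic U V \<tau> u \<and> depends_on_V_alone U V u \<longrightarrow>
            (\<exists>n::int. unit_scalar_multiple u (upow V n)))"
proof -
  interpret irrational_rotation_algebra \<theta> U V by fact
  interpret traced_rotation_algebra \<theta> U V \<tau>
    by unfold_locales fact
  have "harmonic U V \<tau> (z *\<^sub>C (upow U m * upow V n)) \<and>
      strict_local_min_mod_scalars U V \<tau> (z *\<^sub>C (upow U m * upow V n))" if "cmod z = 1" for m n z
    using harmonic_monomial[OF that, of "(m, n)"] strict_local_min_monomial[OF that, of "(m, n)"]
    by (simp add: W_def)
  moreover have "\<exists>m. unit_scalar_multiple u (upow U m)"
    if h: "harmonic U V \<tau> u" "depends_on_U_alone U V u" for u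
  proof -
    have "u \<in> smooth U V" using that by (simp add: harmonic_iff)
    then have dep: "coef u p = 0" if "snd p \<noteq> 0" for p
      using \<open>depends_on_U_alone U V u\<close> that fourier_coeff_eq[of u "fst p" "snd p"]
      by (simp add: depends_on_U_alone_def)
    obtain p where "snd p = 0" "unit_scalar_multiple u (W p)"
      by (rule harmonic_one_generator[of fst snd u]) (use h(1) dep in simp_all)
    then show ?thesis by (auto simp: W_def)
  qed
  moreover have "\<exists>n. unit_scalar_multiple u (upow V n)"
    if h: "harmonic U V \<tau> u" "depends_on_V_alone U V u" for u
  proof -
    have "u \<in> smooth U V" using that by (simp add: harmonic_iff)
    then have dep: "coef u p = 0" if "fst p \<noteq> 0" for p
      using \<open>depends_on_V_alone U V u\<close> that fourier_coeff_eq[of u "fst p" "snd p"]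
      by (simp add: depends_on_V_alone_def)
    obtain p where "fst p = 0" "unit_scalar_multiple u (W p)"
      by (rule harmonic_one_generator[of snd fst u]) (use h(1) dep in simp_all)
    then show ?thesis by (auto simp: W_def)
  qed
  ultimately show ?thesis by blast
qed

end
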